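(* Let $k$ be an algebraically closed field of characteristic zero and let $L$ be a filiform Lie algebra over $k$ of one of the types $L_n$, $Q_n$, $R_n$, $W_n$. Then $L$ satisfies Rentschler's property. In fact $L_n$, $R_n$ and $W_n$ admit a CP. Furthermore, $\alpha(L_n)=n-1$, $\alpha(Q_n)=n/2$, $\alpha(R_n)=n-2$ and $\alpha(W_n)=[(n+2)/2]$. Also, Milovanov's conjecture is valid for $L$, i.e. there exists a complete Poisson commutative subalgebra of $S(L)$ generated by elements of degree at most two.
   Context: $[r]$ denotes the greatest integer $\le r$. Let $C^1(L)=L$, $C^i(L)=[L,C^{i-1}(L)]$ for $i\ge 2$, be the descending central series. An $n$-dimensional Lie algebra $L$ is filiform if $\dim C^i(L)=n-i$ for $i=2,\dots,n$. The types are defined on a basis $x_1,\dots,x_n$ by the following brackets (brackets not determined by these and antisymmetry are zero): - $L_n$ ($n\ge 3$): $[x_1,x_i]=x_{i+1}$, $i=2,\dots,n-1$. - $Q_n$ ($n=2q$): $[x_1,x_i]=x_{i+1}$, $i=2,\dots,n-2$, and $[x_j,x_{n-j+1}]=(-1)^{j+1}x_n$, $j=2,\dots,q$. - $R_n$ ($n\ge 5$): $[x_1,x_i]=x_{i+1}$, $i=2,\dots,n-1$, and $[x_2,x_j]=x_{j+2}$, $j=3,\dots,n-2$. - $W_n$: up to isomorphism, $[x_i,x_j]=(j-i)x_{i+j}$ for $i,j\ge 1$, $i+j\le n$. For $\xi\in L^*$ put $L(\xi)=\{x\in L : \xi([x,y])=0 \text{ for all } y\in L\}$; the index is $i(L)=\min_{\xi\in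 L^*}\dim L(\xi)$; the magic number is $c(L)=(\dim L+i(L))/2$ (an integer). $\alpha(L)$ denotes the maximum dimension of an abelian subalgebra of $L$. A CP (commutative polarization) of $L$ is a commutative subalgebra $P$ of $L$ with $\dim P=c(L)$. $L$ satisfies Rentschler's property if it admits either a CP or an abelian subalgebra of dimension $c(L)-1$, in other words if $\alpha(L)\ge c(L)-1$. The symmetric algebra $S(L)=k[x_1,\dots,x_n]$ carries the Poisson bracket $\{f,g\}=\sum_{i,j}[x_i,x_j]\frac{\partial f}{\partial x_i}\frac{\partial g}{\partial x_j}$. A subalgebra $A\subset S(L)$ is Poisson commutative if $\{f,g\}=0$ for all $f,g\in A$; then $\operatorname{trdeg}_k A\le c(L)$, and $A$ is complete if equality holds.
   Formalization: α(Q_n)=n/2 is stated only for n≥6: it fails for Q_2 (abelian of dimension 2, α=2) and for Q_4 (span of x_1, x_3, x_4 is abelian, so α=3). All other claims cover every Q_n with n even. *)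

theory Defs
  imports Complex_Main "HOL-Computational_Algebra.Polynomial" "HOL-Library.Poly_Mapping"
begin

subsection \<open>Lie algebras\<close>

locale lie_algebra = vector_space scale
  for scale :: "'k::field \<Rightarrow> 'a::ab_group_add \<Rightarrow> 'a" +
  fixes bracket :: "'a \<Rightarrow> 'a \<Rightarrow> 'a"
  assumes bracket_add_left: "bracket (x + y) z = bracket x z + bracket y z"
    and bracket_add_right: "bracket x (y + z) = bracket x y + bracket x z"
    and bracket_scale_left: "bracket (scale c x) y = scale c (bracket x y)"
    and bracket_scale_right: "bracket x (scale c y) = scale c (bracket x y)"
    and bracket_alternating: "bracket x x = 0"
    and jacobi: "bracket x (bracket y z) + bracket y (bracket z x) + bracket z (bracket x y) = 0"
begin

text \<open>The Lie algebra \<open>L\<close> is the whole type \<open>'a\<close>. A basis \<open>x\<^sub>1, \<dots>, x\<^sub>n\<close> is the restriction of a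
  function on \<open>nat\<close> to \<open>{1..n}\<close>; its values elsewhere are irrelevant.\<close>

definition basis :: "nat \<Rightarrow> (nat \<Rightarrow> 'a) \<Rightarrow> bool" where
  "basis n x \<longleftrightarrow> inj_on x {1..n} \<and> independent (x ` {1..n}) \<and> span (x ` {1..n}) = UNIV"

text \<open>The descending central series is indexed from 1; the value at 0 is a dummy.\<close>

fun central_series :: "nat \<Rightarrow> 'a set" where
  "central_series 0 = UNIV"
| "central_series (Suc 0) = UNIV"
| "central_series (Suc (Suc i)) = span {bracket x y |x y. y \<in> central_series (Suc i)}"

definition filiform :: "nat \<Rightarrow> bool" where
  "filiform n \<longleftrightarrow> (\<exists>x. basis n x) \<and> (\<forall>i\<in>{2..n}. dim (central_series i) = n - i)"

text \<open>Each type is given by the brackets \<open>[x\<^sub>i, x\<^sub>j]\<close> with \<open>i < j\<close>; the others follow by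
  antisymmetry. In type \<open>Q\<close>, the pairs \<open>2 \<le> i < j\<close> with \<open>i + j = n + 1\<close> are exactly the pairs
  \<open>(i, n - i + 1)\<close> with \<open>2 \<le> i \<le> n / 2\<close>. The degenerate cases \<open>Q\<^sub>2\<close> (abelian) and
  \<open>Q\<^sub>4\<close> (isomorphic to \<open>L\<^sub>4\<close>) are admitted; they do not satisfy \<open>\<alpha>(Q\<^sub>n) = n / 2\<close>.\<close>

definition type_L :: "nat \<Rightarrow> (nat \<Rightarrow> 'a) \<Rightarrow> bool" where
  "type_L n x \<longleftrightarrow> n \<ge> 3 \<and> basis n x \<and>
     (\<forall>i j. 1 \<le> i \<and> i < j \<and> j \<le> n \<longrightarrow>
        bracket (x i) (x j) = (if i = 1 \<and> j + 1 \<le> n then x (j + 1) else 0))"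

definition type_Q :: "nat \<Rightarrow> (nat \<Rightarrow> 'a) \<Rightarrow> bool" where
  "type_Q n x \<longleftrightarrow> n \<ge> 1 \<and> even n \<and> basis n x \<and>
     (\<forall>i j. 1 \<le> i \<and> i < j \<and> j \<le> n \<longrightarrow>
        bracket (x i) (x j) =
          (if i = 1 \<and> j + 2 \<le> n then x (j + 1)
           else if 2 \<le> i \<and> i + j = n + 1 then scale ((- 1) ^ (i + 1)) (x n)
           else 0))"

definition type_R :: "nat \<Rightarrow> (nat \<Rightarrow> 'a) \<Rightarrow> bool" where
  "type_R n x \<longleftrightarrow> n \<ge> 5 \<and> basis n x \<and>
     (\<forall>i j. 1 \<le> i \<and> i < j \<and> j \<le> n \<longrightarrow>
        bracket (x i) (x j) =
          (if i = 1 \<and> j + 1 \<le> n then x (j + 1)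
           else if i = 2 \<and> j + 2 \<le> n then x (j + 2)
           else 0))"

definition type_W :: "nat \<Rightarrow> (nat \<Rightarrow> 'a) \<Rightarrow> bool" where
  "type_W n x \<longleftrightarrow> n \<ge> 1 \<and> basis n x \<and>
     (\<forall>i j. 1 \<le> i \<and> i < j \<and> j \<le> n \<longrightarrow>
        bracket (x i) (x j) = (if i + j \<le> n then scale (of_nat (j - i)) (x (i + j)) else 0))"

definition stabilizer :: "('a \<Rightarrow> 'k) \<Rightarrow> 'a set" where
  "stabilizer \<xi> = {x. \<forall>y. \<xi> (bracket x y) = 0}"

definition index :: nat where
  "index = (LEAST d. \<exists>\<xi>. Vector_Spaces.linear scale (*) \<xi> \<and> d = dim (stabilizer \<xi>))"

text \<open>The sum \<open>dim L + i(L)\<close> is always even, so the division is exact.\<close>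

definition magic_number :: nat where
  "magic_number = (dim (UNIV :: 'a set) + index) div 2"

definition abelian_subalgebra :: "'a set \<Rightarrow> bool" where
  "abelian_subalgebra P \<longleftrightarrow> subspace P \<and> (\<forall>x\<in>P. \<forall>y\<in>P. bracket x y = 0)"

definition alpha :: nat where
  "alpha = Max {dim P |P. abelian_subalgebra P}"

definition CP :: "'a set \<Rightarrow> bool" where
  "CP P \<longleftrightarrow> abelian_subalgebra P \<and> dim P = magic_number"

definition rentschler :: bool where
  "rentschler \<longleftrightarrow>
     (\<exists>P. CP P) \<or> (\<exists>P. abelian_subalgebra P \<and> int (dim P) = int magic_number - 1)"

end


subsection \<open>Multivariate polynomials\<close>

text \<open>Exponent vectors are finitely supported functions on the variables, and polynomials are
  finitely supported functions on exponent vectors.\<close>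

type_synonym ('v, 'k) mpoly = "('v \<Rightarrow>\<^sub>0 nat) \<Rightarrow>\<^sub>0 'k"

definition const_poly :: "'k::zero \<Rightarrow> ('v, 'k) mpoly" where
  "const_poly c = Poly_Mapping.single 0 c"

definition var_poly :: "'v \<Rightarrow> ('v, 'k::zero_neq_one) mpoly" where
  "var_poly v = Poly_Mapping.single (Poly_Mapping.single v 1) 1"

definition variables :: "('v, 'k::zero) mpoly \<Rightarrow> 'v set" where
  "variables f = (\<Union>m\<in>Poly_Mapping.keys f. Poly_Mapping.keys m)"

definition degree_le :: "nat \<Rightarrow> ('v, 'k::zero) mpoly \<Rightarrow> bool" where
  "degree_le d f \<longleftrightarrow> (\<forall>m\<in>Poly_Mapping.keys f. (\<Sum>v\<in>Poly_Mapping.keys m. Poly_Mapping.lookup m v) \<le> d)"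

text \<open>If \<open>v\<close> does not occur in the monomial \<open>m\<close>, the subtraction truncates, but then the
  coefficient is 0.\<close>

definition partial :: "'v \<Rightarrow> ('v, 'k::comm_semiring_1) mpoly \<Rightarrow> ('v, 'k) mpoly" where
  "partial v f = (\<Sum>m\<in>Poly_Mapping.keys f.
     Poly_Mapping.single (m - Poly_Mapping.single v 1) (of_nat (Poly_Mapping.lookup m v) * Poly_Mapping.lookup f m))"

definition substitute ::
    "('v \<Rightarrow> ('w, 'k) mpoly) \<Rightarrow> ('v, 'k::comm_semiring_1) mpoly \<Rightarrow> ('w, 'k) mpoly" where
  "substitute \<phi> p = (\<Sum>m\<in>Poly_Mapping.keys p. const_poly (Poly_Mapping.lookup p m) * (\<Prod>v\<in>Poly_Mapping.keys m. \<phi> v ^ Poly_Mapping.lookup m v))"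

definition unital_subalgebra :: "('v, 'k::comm_semiring_1) mpoly set \<Rightarrow> bool" where
  "unital_subalgebra A \<longleftrightarrow> range const_poly \<subseteq> A \<and> (\<forall>f\<in>A. \<forall>g\<in>A. f + g \<in> A \<and> f * g \<in> A)"

text \<open>Algebraic independence over \<open>'k\<close>: the polynomial relations on \<open>B\<close> are written with the
  elements of \<open>B\<close> themselves as variables.\<close>

definition alg_independent :: "('v, 'k::comm_semiring_1) mpoly set \<Rightarrow> bool" where
  "alg_independent B \<longleftrightarrow>
     (\<forall>p :: (('v, 'k) mpoly, 'k) mpoly. variables p \<subseteq> B \<and> substitute (\<lambda>b. b) p = 0 \<longrightarrow> p = 0)"

definition transcendence_basis ::
    "('v, 'k::comm_semiring_1) mpoly set \<Rightarrow> ('v, 'k) mpoly set \<Rightarrow> bool" where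
  "transcendence_basis A B \<longleftrightarrow>
     B \<subseteq> A \<and> alg_independent B \<and> (\<forall>a\<in>A - B. \<not> alg_independent (insert a B))"

text \<open>Over a field the polynomial ring is a domain, so all transcendence bases of a subalgebra have
  the same cardinality.\<close>

definition has_trdeg :: "('v, 'k::comm_semiring_1) mpoly set \<Rightarrow> nat \<Rightarrow> bool" where
  "has_trdeg A d \<longleftrightarrow> (\<exists>B. transcendence_basis A B \<and> finite B \<and> card B = d)"


subsection \<open>The Poisson algebra \<open>S(L) = k[x\<^sub>1, \<dots>, x\<^sub>n]\<close>\<close>

definition sym_algebra :: "nat \<Rightarrow> (nat, 'k::zero) mpoly set" where
  "sym_algebra n = {f. variables f \<subseteq> {1..n}}"

context lie_algebra
begin

text \<open>The inclusion of \<open>L\<close> into \<open>S(L)\<close> as the linear forms in the basis \<open>x\<close>.\<close>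

definition linear_form :: "nat \<Rightarrow> (nat \<Rightarrow> 'a) \<Rightarrow> 'a \<Rightarrow> (nat, 'k) mpoly" where
  "linear_form n x v =
     (\<Sum>i=1..n. const_poly (representation (x ` {1..n}) v (x i)) * var_poly i)"

definition poisson ::
    "nat \<Rightarrow> (nat \<Rightarrow> 'a) \<Rightarrow> (nat, 'k) mpoly \<Rightarrow> (nat, 'k) mpoly \<Rightarrow> (nat, 'k) mpoly" where
  "poisson n x f g =
     (\<Sum>i=1..n. \<Sum>j=1..n. linear_form n x (bracket (x i) (x j)) * partial i f * partial j g)"

definition poisson_commutative ::
    "nat \<Rightarrow> (nat \<Rightarrow> 'a) \<Rightarrow> (nat, 'k) mpoly set \<Rightarrow> bool" where
  "poisson_commutative n x A \<longleftrightarrow>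
     unital_subalgebra A \<and> A \<subseteq> sym_algebra n \<and> (\<forall>f\<in>A. \<forall>g\<in>A. poisson n x f g = 0)"

definition complete_poisson_commutative ::
    "nat \<Rightarrow> (nat \<Rightarrow> 'a) \<Rightarrow> (nat, 'k) mpoly set \<Rightarrow> bool" where
  "complete_poisson_commutative n x A \<longleftrightarrow> poisson_commutative n x A \<and> has_trdeg A magic_number"

definition milovanov :: "nat \<Rightarrow> (nat \<Rightarrow> 'a) \<Rightarrow> bool" where
  "milovanov n x \<longleftrightarrow>
     (\<exists>A G. complete_poisson_commutative n x A \<and>
        (\<forall>g\<in>G. degree_le 2 g) \<and> A = unital_subalgebra hull G)"

end

end

theory Submission
  imports Defs
begin

text \<open>
  Every value of the index and of \<open>\<alpha>\<close> comes from one estimate (\<open>isotropic_dim_bound\<close>): if a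
  subspace \<open>P\<close> is isotropic for the alternating form \<open>\<xi>([a, b])\<close>, then
  \<open>2 dim P \<le> n + dim (P \<inter> L(\<xi>))\<close>. An abelian subalgebra is isotropic for all \<open>\<xi>\<close> at once, so it
  bounds every \<open>dim L(\<xi>)\<close> from below, and a single \<open>\<xi>\<close> bounds all abelian subalgebras from above.
  Whenever an abelian \<open>P\<close> and a functional \<open>\<xi>\<close> satisfy \<open>dim L(\<xi>) + n \<le> 2 dim P\<close>, the two bounds
  meet and give \<open>c(L) = \<alpha>(L) = dim P\<close> (\<open>magic_number_alpha_of_abelian_polarization\<close>).

  For \<open>L\<^sub>n\<close>, \<open>R\<^sub>n\<close> and \<open>W\<^sub>n\<close> this applies with \<open>\<xi>\<close> the coordinate of \<open>x\<^sub>n\<close> and with \<open>P\<close> spanned by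
  \<open>x\<^sub>2, \<dots>, x\<^sub>n\<close>, by \<open>x\<^sub>3, \<dots>, x\<^sub>n\<close> and by the \<open>x\<^sub>i\<close> with \<open>2i \<ge> n\<close>, respectively: in each case the
  form of \<open>\<xi>\<close> pairs off some basis vectors and kills the others, which span \<open>L(\<xi>)\<close>. The subalgebra
  of \<open>S(L)\<close> generated by the basis vectors in \<open>P\<close> is then Poisson commutative and complete.

  For \<open>Q\<^sub>n\<close>, \<open>n = 2q\<close>, the same functional has \<open>L(\<xi>)\<close> inside the span of \<open>x\<^sub>1\<close> and \<open>x\<^sub>n\<close>, while the
  abelian subalgebra spanned by \<open>x\<^sub>q\<^sub>+\<^sub>1, \<dots>, x\<^sub>n\<close> has dimension only \<open>q\<close>. It contains the central
  vector \<open>x\<^sub>n\<close>, so for each \<open>\<xi>\<close> a dimension count extends it to an isotropic subspace of dimension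
  \<open>q + 1\<close>; hence the index is 2 and \<open>c = q + 1\<close>. An abelian subalgebra of dimension above \<open>q\<close> would
  have to contain \<open>x\<^sub>1\<close>, whose centralizer is spanned by \<open>x\<^sub>1\<close>, \<open>x\<^sub>n\<^sub>-\<^sub>1\<close>, \<open>x\<^sub>n\<close> and is too small once
  \<open>n \<ge> 6\<close>. For a complete subalgebra of \<open>S(L)\<close>, these \<open>q\<close> vectors need one more generator, the quadratic
  \<open>f = x\<^sub>1 x\<^sub>n + \<Sum> (-1)\<^sup>j x\<^sub>j x\<^sub>n\<^sub>+\<^sub>2\<^sub>-\<^sub>j\<close>, summed over \<open>3 \<le> j \<le> q\<close>. It differs by a multiple of the
  square of \<open>x\<^sub>q\<^sub>+\<^sub>1\<close> from the quadratic Casimir element of \<open>Q\<^sub>n\<close>, so it still commutes with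
  \<open>x\<^sub>q\<^sub>+\<^sub>1, \<dots>, x\<^sub>n\<close>; and setting \<open>x\<^sub>2, \<dots>, x\<^sub>q\<close> to 0 turns it into the monomial \<open>x\<^sub>1 x\<^sub>n\<close>, which makes
  its independence of those variables visible.

  On the polynomial side, the subalgebra generated by a finite algebraically independent set \<open>G\<close> has
  transcendence degree \<open>|G|\<close> (\<open>has_trdeg_hull\<close>), and independence can be tested after a substitution
  that turns the generators into monomials (\<open>alg_independent_if_monomial_image\<close>).
\<close>

section \<open>Polynomials as finitely supported functions\<close>

text \<open>Sums and products of polynomials are determined on monomials, so the rules for \<open>partial\<close> and
  \<open>substitute\<close> below are all reduced to a single computation by this induction.\<close>

lemma mpoly_induct [case_names zero monomial add]:
  assumes "P 0" and "\<And>m c. P (Poly_Mapping.single m c)" and "\<And>f g. P f \<Longrightarrow> P g \<Longrightarrow> P (f + g)"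
  shows "P (f :: 'a \<Rightarrow>\<^sub>0 'b::monoid_add)"
proof (induction f rule: Poly_Mapping.update_induct)
  case const
  show ?case by (fact assms(1))
next
  case (update f a b)
  have "Poly_Mapping.update a b f = f + Poly_Mapping.single a b"
    by (rule poly_mapping_eqI)
      (use update(1) in \<open>auto simp: Poly_Mapping.lookup_update lookup_add lookup_single in_keys_iff\<close>)
  then show ?case using assms(2,3) update(3) by simp
qed

lemma keys_add_nat:
  "Poly_Mapping.keys (m + m' :: 'v \<Rightarrow>\<^sub>0 nat) = Poly_Mapping.keys m \<union> Poly_Mapping.keys m'"
  by (auto simp: in_keys_iff lookup_add)

text \<open>The sum defining a derivative ranges over the monomials of \<open>f\<close>; additivity needs a range of
  summation that is common to several polynomials.\<close>

lemma partial_eq_sum: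
  assumes "finite S" "Poly_Mapping.keys f \<subseteq> S"
  shows "partial v f = (\<Sum>m\<in>S. Poly_Mapping.single (m - Poly_Mapping.single v 1)
           (of_nat (Poly_Mapping.lookup m v) * Poly_Mapping.lookup f m))"
  unfolding partial_def
  by (rule sum.mono_neutral_left) (use assms in \<open>auto simp: in_keys_iff\<close>)

lemma partial_single:
  "partial v (Poly_Mapping.single m c) =
     Poly_Mapping.single (m - Poly_Mapping.single v 1) (of_nat (Poly_Mapping.lookup m v) * c)"
  by (subst partial_eq_sum[of "{m}"]) auto

lemma partial_add: "partial v (f + g) = partial v f + partial v g"
proof -
  let ?S = "Poly_Mapping.keys f \<union> Poly_Mapping.keys g"
  have "Poly_Mapping.keys (f + g) \<subseteq> ?S" by (rule keys_add)
  then show ?thesis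
    by (simp add: partial_eq_sum[of ?S] lookup_add algebra_simps single_add sum.distrib)
qed

lemma partial_zero [simp]: "partial v 0 = 0"
  by (simp add: partial_def)

lemma partial_const [simp]: "partial v (const_poly c) = 0"
  by (simp add: const_poly_def partial_single)

lemma partial_var: "partial v (var_poly w) = (if v = w then 1 else 0)"
  by (auto simp: var_poly_def partial_single lookup_single)

lemma partial_mult_single:
  "partial v (Poly_Mapping.single m c * Poly_Mapping.single m' c') =
     partial v (Poly_Mapping.single m c) * Poly_Mapping.single m' c' +
     Poly_Mapping.single m c * partial v (Poly_Mapping.single m' c')"
proof -
  let ?e = "Poly_Mapping.single v (1::nat)"
  \<comment> \<open>The subtraction of exponents is truncated, so this rule needs the variable to occur in \<open>m\<close>;
      otherwise the coefficient in front vanishes.\<close>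
  have *: "m + m' - ?e = (m - ?e) + m'" if "Poly_Mapping.lookup m v > 0" for m m' :: "'a \<Rightarrow>\<^sub>0 nat"
    by (rule poly_mapping_eqI) (use that in \<open>auto simp: lookup_add lookup_minus lookup_single when_def\<close>)
  have 1: "Poly_Mapping.single (m + m' - ?e) (of_nat (Poly_Mapping.lookup m v) * (c * c'))
     = Poly_Mapping.single ((m - ?e) + m') (of_nat (Poly_Mapping.lookup m v) * (c * c'))"
    using *[of m m'] by (cases "Poly_Mapping.lookup m v = 0") auto
  have 2: "Poly_Mapping.single (m + m' - ?e) (of_nat (Poly_Mapping.lookup m' v) * (c * c'))
     = Poly_Mapping.single (m + (m' - ?e)) (of_nat (Poly_Mapping.lookup m' v) * (c * c'))"
    using *[of m' m] by (cases "Poly_Mapping.lookup m' v = 0") (auto simp: add.commute)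
  have "partial v (Poly_Mapping.single m c * Poly_Mapping.single m' c') =
      Poly_Mapping.single (m + m' - ?e) (of_nat (Poly_Mapping.lookup m v) * (c * c')) +
      Poly_Mapping.single (m + m' - ?e) (of_nat (Poly_Mapping.lookup m' v) * (c * c'))"
    by (simp only: mult_single partial_single lookup_add of_nat_add distrib_right single_add)
  also have "\<dots> = partial v (Poly_Mapping.single m c) * Poly_Mapping.single m' c' +
     Poly_Mapping.single m c * partial v (Poly_Mapping.single m' c')"
    unfolding 1 2 by (simp only: mult_single partial_single) (simp only: mult_ac)
  finally show ?thesis .
qed

lemma partial_mult: "partial v (f * g) = partial v f * g + f * partial v g"
proof (induction f rule: mpoly_induct)
  case (monomial m c)
  show ?case
  proof (induction g rule: mpoly_induct)
    case (monomial m' c')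
    show ?case by (rule partial_mult_single)
  qed (auto simp: partial_add algebra_simps)
qed (auto simp: partial_add algebra_simps)

lemma prod_power_keys_eq:
  fixes m :: "'v \<Rightarrow>\<^sub>0 nat"
  assumes "finite S" "Poly_Mapping.keys m \<subseteq> S"
  shows "(\<Prod>v\<in>Poly_Mapping.keys m. \<phi> v ^ Poly_Mapping.lookup m v) =
           (\<Prod>v\<in>S. (\<phi> v :: 'c::comm_monoid_mult) ^ Poly_Mapping.lookup m v)"
  by (rule prod.mono_neutral_left) (use assms in \<open>auto simp: in_keys_iff\<close>)

lemma prod_power_keys_add:
  fixes m m' :: "'v \<Rightarrow>\<^sub>0 nat"
  shows "(\<Prod>v\<in>Poly_Mapping.keys (m + m'). \<phi> v ^ Poly_Mapping.lookup (m + m') v) =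
    (\<Prod>v\<in>Poly_Mapping.keys m. \<phi> v ^ Poly_Mapping.lookup m v) *
    (\<Prod>v\<in>Poly_Mapping.keys m'. (\<phi> v :: 'c::comm_monoid_mult) ^ Poly_Mapping.lookup m' v)"
proof -
  let ?S = "Poly_Mapping.keys m \<union> Poly_Mapping.keys m'"
  show ?thesis
    by (simp add: prod_power_keys_eq[of ?S] keys_add_nat lookup_add power_add prod.distrib)
qed

lemma const_poly_add: "const_poly (c + d) = const_poly c + const_poly d"
  by (simp add: const_poly_def single_add)

lemma const_poly_mult: "const_poly (c * d) = const_poly c * const_poly d"
  by (simp add: const_poly_def mult_single)

lemma const_poly_zero [simp]: "const_poly 0 = 0"
  by (simp add: const_poly_def)

lemma const_poly_one [simp]: "const_poly 1 = 1"
  by (simp add: const_poly_def)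

lemma substitute_single:
  "substitute \<phi> (Poly_Mapping.single m c) =
     const_poly c * (\<Prod>v\<in>Poly_Mapping.keys m. \<phi> v ^ Poly_Mapping.lookup m v)"
  by (simp add: substitute_def)

lemma substitute_zero [simp]: "substitute \<phi> 0 = 0"
  by (simp add: substitute_def)

lemma substitute_add: "substitute \<phi> (f + g) = substitute \<phi> f + substitute \<phi> g"
proof -
  let ?S = "Poly_Mapping.keys f \<union> Poly_Mapping.keys g"
  have *: "substitute \<phi> h = (\<Sum>m\<in>?S. const_poly (Poly_Mapping.lookup h m) *
      (\<Prod>v\<in>Poly_Mapping.keys m. \<phi> v ^ Poly_Mapping.lookup m v))" if "Poly_Mapping.keys h \<subseteq> ?S" for h
    unfolding substitute_def
    by (rule sum.mono_neutral_left) (use that in \<open>auto simp: in_keys_iff\<close>)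
  show ?thesis
    using keys_add[of f g]
    by (simp add: * lookup_add const_poly_add algebra_simps sum.distrib)
qed

lemma substitute_mult: "substitute \<phi> (f * g) = substitute \<phi> f * substitute \<phi> g"
proof (induction f rule: mpoly_induct)
  case (monomial m c)
  show ?case
  proof (induction g rule: mpoly_induct)
    case (monomial m' c')
    show ?case
      by (simp add: mult_single substitute_single prod_power_keys_add const_poly_mult mult_ac)
  qed (auto simp: substitute_add algebra_simps)
qed (auto simp: substitute_add algebra_simps)

lemma substitute_const [simp]: "substitute \<phi> (const_poly c) = const_poly c"
  unfolding const_poly_def[of c] substitute_single by simp

lemma substitute_one [simp]: "substitute \<phi> 1 = 1"
  using substitute_const[of \<phi> 1] by simp

lemma substitute_var [simp]: "substitute \<phi> (var_poly v) = \<phi> v"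
  by (simp add: var_poly_def substitute_single)

lemma substitute_power: "substitute \<phi> (f ^ k) = substitute \<phi> f ^ k"
  by (induction k) (simp_all add: substitute_mult)

lemma substitute_prod: "substitute \<phi> (\<Prod>i\<in>I. f i) = (\<Prod>i\<in>I. substitute \<phi> (f i))"
  by (induction I rule: infinite_finite_induct) (simp_all add: substitute_mult)

lemma substitute_sum: "substitute \<phi> (\<Sum>i\<in>I. f i) = (\<Sum>i\<in>I. substitute \<phi> (f i))"
  by (induction I rule: infinite_finite_induct) (simp_all add: substitute_add)

lemma substitute_substitute:
  "substitute \<phi> (substitute \<psi> p) = substitute (\<lambda>v. substitute \<phi> (\<psi> v)) p"
  by (simp add: substitute_def[of \<psi>] substitute_def[of "\<lambda>v. substitute \<phi> (\<psi> v)"]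
      substitute_sum substitute_mult substitute_prod substitute_power)

lemma variables_add: "variables (f + g) \<subseteq> variables f \<union> variables g"
  using keys_add[of f g] by (auto simp: variables_def)

lemma variables_mult: "variables (f * g) \<subseteq> variables f \<union> variables g"
proof
  fix v assume "v \<in> variables (f * g)"
  then obtain m where "m \<in> Poly_Mapping.keys (f * g)" "v \<in> Poly_Mapping.keys m"
    by (auto simp: variables_def)
  moreover obtain a b where "m = a + b" "a \<in> Poly_Mapping.keys f" "b \<in> Poly_Mapping.keys g"
    using keys_mult[of f g] calculation(1) by auto
  ultimately show "v \<in> variables f \<union> variables g"
    by (auto simp: variables_def keys_add_nat)
qed

lemma variables_const [simp]: "variables (const_poly c) = {}"
  by (simp add: variables_def const_poly_def)

lemma variables_var: "variables (var_poly v :: ('v, 'k::zero_neq_one) mpoly) = {v}"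
  by (simp add: variables_def var_poly_def)

lemma var_poly_eq_iff [simp]:
  "(var_poly v :: ('v, 'k::zero_neq_one) mpoly) = var_poly w \<longleftrightarrow> v = w"
  by (metis variables_var singleton_inject)

lemma degree_le_mono: "degree_le d f \<Longrightarrow> d \<le> e \<Longrightarrow> degree_le e f"
  by (auto simp: degree_le_def)

lemma degree_le_zero [simp]: "degree_le d 0"
  by (simp add: degree_le_def)

lemma degree_le_const [simp]: "degree_le d (const_poly c)"
  by (simp add: degree_le_def const_poly_def)

lemma degree_le_var: "degree_le 1 (var_poly v :: ('v, 'k::zero_neq_one) mpoly)"
  by (simp add: degree_le_def var_poly_def)

lemma degree_le_add: "degree_le d f \<Longrightarrow> degree_le d g \<Longrightarrow> degree_le d (f + g)"
  using keys_add[of f g] by (auto simp: degree_le_def)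

lemma degree_le_sum: "(\<And>i. i \<in> I \<Longrightarrow> degree_le d (f i)) \<Longrightarrow> degree_le d (\<Sum>i\<in>I. f i)"
  by (induction I rule: infinite_finite_induct) (auto intro: degree_le_add)

lemma degree_le_mult:
  assumes "degree_le d f" "degree_le e g"
  shows "degree_le (d + e) (f * g)"
  unfolding degree_le_def
proof
  let ?deg = "\<lambda>m S. \<Sum>v\<in>S. Poly_Mapping.lookup m v"
  fix m assume "m \<in> Poly_Mapping.keys (f * g)"
  then obtain a b where m: "m = a + b" "a \<in> Poly_Mapping.keys f" "b \<in> Poly_Mapping.keys g"
    using keys_mult[of f g] by auto
  have "?deg a (Poly_Mapping.keys a \<union> Poly_Mapping.keys b) = ?deg a (Poly_Mapping.keys a)"
    "?deg b (Poly_Mapping.keys a \<union> Poly_Mapping.keys b) = ?deg b (Poly_Mapping.keys b)"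
    by (rule sum.mono_neutral_right; auto simp: in_keys_iff)+
  then show "?deg m (Poly_Mapping.keys m) \<le> d + e"
    using assms m by (auto simp: degree_le_def keys_add_nat lookup_add sum.distrib intro!: add_mono)
qed


section \<open>Algebraic independence and transcendence degree\<close>

lemma unital_subalgebra_hull: "unital_subalgebra (unital_subalgebra hull G)"
  by (rule hull_in) (auto simp: unital_subalgebra_def)

lemma hull_induct_subalgebra [consumes 1, case_names generator const add mult]:
  assumes "f \<in> unital_subalgebra hull G"
    and "\<And>g. g \<in> G \<Longrightarrow> P g" and "\<And>c. P (const_poly c)"
    and "\<And>f g. P f \<Longrightarrow> P g \<Longrightarrow> P (f + g)" and "\<And>f g. P f \<Longrightarrow> P g \<Longrightarrow> P (f * g)"
  shows "P f"
proof -
  have "unital_subalgebra hull G \<subseteq> {f. P f}"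
    by (rule hull_minimal) (use assms in \<open>auto simp: unital_subalgebra_def\<close>)
  then show ?thesis using assms(1) by auto
qed

lemma unital_subalgebra_sym_algebra: "unital_subalgebra (sym_algebra n)"
  using variables_add variables_mult by (fastforce simp: unital_subalgebra_def sym_algebra_def)

lemma hull_is_polynomial_in_generators:
  assumes "f \<in> unital_subalgebra hull (G :: ('v, 'k::comm_semiring_1) mpoly set)"
  obtains p where "variables p \<subseteq> G" "substitute (\<lambda>b. b) p = f"
proof -
  have "\<exists>p. variables p \<subseteq> G \<and> substitute (\<lambda>b. b) p = f"
    using assms
  proof (induction f rule: hull_induct_subalgebra)
    case (generator g)
    then show ?case by (intro exI[of _ "var_poly g"]) (simp add: variables_var)
  next
    case (const c)
    show ?case by (intro exI[of _ "const_poly c"]) simp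
  next
    case (add f g)
    then obtain p q where "variables p \<subseteq> G" "substitute (\<lambda>b. b) p = f"
      "variables q \<subseteq> G" "substitute (\<lambda>b. b) q = g" by auto
    then show ?case
      using variables_add[of p q] by (intro exI[of _ "p + q"]) (auto simp: substitute_add)
  next
    case (mult f g)
    then obtain p q where "variables p \<subseteq> G" "substitute (\<lambda>b. b) p = f"
      "variables q \<subseteq> G" "substitute (\<lambda>b. b) q = g" by auto
    then show ?case
      using variables_mult[of p q] by (intro exI[of _ "p * q"]) (auto simp: substitute_mult)
  qed
  then show ?thesis using that by auto
qed

text \<open>An element \<open>a\<close> of the generated subalgebra is a polynomial \<open>p\<close> in the generators; if \<open>a\<close> is
  itself no generator, then the variable \<open>a\<close> minus \<open>p\<close> is a non-trivial relation. So \<open>G\<close> is already a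
  maximal independent subset.\<close>

lemma has_trdeg_hull:
  fixes G :: "('v, 'k::comm_ring_1) mpoly set"
  assumes "finite G" "alg_independent G"
  shows "has_trdeg (unital_subalgebra hull G) (card G)"
proof -
  have "\<not> alg_independent (insert a G)" if a: "a \<in> unital_subalgebra hull G - G" for a
  proof -
    obtain p where p: "variables p \<subseteq> G" "substitute (\<lambda>b. b) p = a"
      using hull_is_polynomial_in_generators a by blast
    let ?r = "var_poly a + const_poly (- 1) * p"
    have "variables ?r \<subseteq> insert a G"
      using variables_add[of "var_poly a" "const_poly (- 1) * p"] variables_mult[of "const_poly (- 1)" p] p(1)
      by (auto simp: variables_var)
    moreover have "substitute (\<lambda>b. b) ?r = 0"
    proof -
      have "const_poly 1 + const_poly (- 1) = (0 :: ('v, 'k) mpoly)"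
        by (simp flip: const_poly_add del: const_poly_one)
      then have "(1 + const_poly (- 1)) * a = 0" by simp
      then show ?thesis
        by (simp add: substitute_add substitute_mult p(2) algebra_simps)
    qed
    moreover have "?r \<noteq> 0"
    proof -
      have "Poly_Mapping.lookup (const_poly (- 1) * p) (Poly_Mapping.single a 1) = 0"
      proof (rule ccontr)
        assume "\<not> ?thesis"
        then have "a \<in> variables (const_poly (- 1) * p)"
          by (auto simp: variables_def in_keys_iff intro!: bexI[of _ "Poly_Mapping.single a 1"])
        then show False using a p(1) variables_mult[of "const_poly (- 1)" p] by auto
      qed
      then have "Poly_Mapping.lookup ?r (Poly_Mapping.single a 1) = 1"
        by (simp add: lookup_add var_poly_def)
      then show ?thesis by auto
    qed
    ultimately show ?thesis unfolding alg_independent_def by blast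
  qed
  moreover have "G \<subseteq> unital_subalgebra hull G" by (rule hull_subset)
  ultimately show ?thesis
    using assms unfolding has_trdeg_def transcendence_basis_def by blast
qed

lemma power_single_one:
  "Poly_Mapping.single \<mu> (1::'k::comm_semiring_1) ^ k = Poly_Mapping.single (\<Sum>i<k. \<mu>) 1"
  by (induction k) (simp_all add: mult_single add.commute flip: single_one)

lemma prod_single_one:
  "(\<Prod>i\<in>I. Poly_Mapping.single (\<mu> i) (1::'k::comm_semiring_1)) = Poly_Mapping.single (\<Sum>i\<in>I. \<mu> i) 1"
  by (induction I rule: infinite_finite_induct) (simp_all add: mult_single flip: single_one)

text \<open>A substitution carries a relation among the elements of \<open>G\<close> to one among their images. If the
  images are monomials with linearly independent exponent vectors, different monomials in the
  generators go to different monomials, and no cancellation is possible. Hypothesis \<open>inj\<close> states the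
  independence of the exponents \<open>\<mu> g\<close>, written in coordinates.\<close>

lemma alg_independent_if_monomial_image:
  fixes G :: "('v, 'k::comm_semiring_1) mpoly set" and \<phi> :: "'v \<Rightarrow> ('w, 'k) mpoly"
    and \<mu> :: "('v, 'k) mpoly \<Rightarrow> 'w \<Rightarrow>\<^sub>0 nat"
  assumes image: "\<And>g. g \<in> G \<Longrightarrow> substitute \<phi> g = Poly_Mapping.single (\<mu> g) 1"
    and inj: "\<And>m m'. Poly_Mapping.keys m \<subseteq> G \<Longrightarrow> Poly_Mapping.keys m' \<subseteq> G \<Longrightarrow>
        (\<And>w. (\<Sum>g\<in>Poly_Mapping.keys m. Poly_Mapping.lookup m g * Poly_Mapping.lookup (\<mu> g) w) =
              (\<Sum>g\<in>Poly_Mapping.keys m'. Poly_Mapping.lookup m' g * Poly_Mapping.lookup (\<mu> g) w)) \<Longrightarrow>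
        m = m'"
  shows "alg_independent G"
  unfolding alg_independent_def
proof (intro allI impI, elim conjE)
  fix p :: "(('v, 'k) mpoly, 'k) mpoly"
  assume vars: "variables p \<subseteq> G" and zero: "substitute (\<lambda>b. b) p = 0"
  define E where "E m = (\<Sum>g\<in>Poly_Mapping.keys m. \<Sum>i<Poly_Mapping.lookup m g. \<mu> g)"
    for m :: "('v, 'k) mpoly \<Rightarrow>\<^sub>0 nat"
  have keys: "Poly_Mapping.keys m \<subseteq> G" if "m \<in> Poly_Mapping.keys p" for m
    using vars that by (auto simp: variables_def)
  have E_inj: "E m = E m' \<longleftrightarrow> m = m'" if "m \<in> Poly_Mapping.keys p" "m' \<in> Poly_Mapping.keys p" for m m'
  proof
    have lookup_E: "Poly_Mapping.lookup (E m) w =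
        (\<Sum>g\<in>Poly_Mapping.keys m. Poly_Mapping.lookup m g * Poly_Mapping.lookup (\<mu> g) w)"
      for m :: "('v, 'k) mpoly \<Rightarrow>\<^sub>0 nat" and w
      by (simp add: E_def lookup_sum)
    assume "E m = E m'"
    then show "m = m'"
      using inj[OF keys keys] that by (simp flip: lookup_E)
  qed simp
  have "0 = substitute (\<lambda>g. substitute \<phi> g) p"
    using zero substitute_substitute[of \<phi> "\<lambda>b. b" p] by simp
  also have "\<dots> = (\<Sum>m\<in>Poly_Mapping.keys p. Poly_Mapping.single (E m) (Poly_Mapping.lookup p m))"
    unfolding substitute_def[of "\<lambda>g. substitute \<phi> g"]
  proof (rule sum.cong)
    fix m assume m: "m \<in> Poly_Mapping.keys p"
    have "(\<Prod>g\<in>Poly_Mapping.keys m. substitute \<phi> g ^ Poly_Mapping.lookup m g) =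
        (\<Prod>g\<in>Poly_Mapping.keys m. Poly_Mapping.single (\<Sum>i<Poly_Mapping.lookup m g. \<mu> g) 1)"
      using keys[OF m] by (intro prod.cong) (auto simp: image power_single_one)
    then show "const_poly (Poly_Mapping.lookup p m) *
        (\<Prod>g\<in>Poly_Mapping.keys m. substitute \<phi> g ^ Poly_Mapping.lookup m g) =
        Poly_Mapping.single (E m) (Poly_Mapping.lookup p m)"
      by (simp add: prod_single_one E_def const_poly_def mult_single)
  qed simp
  finally have sum0: "(\<Sum>m\<in>Poly_Mapping.keys p. Poly_Mapping.single (E m) (Poly_Mapping.lookup p m)) = 0"
    by simp
  have "Poly_Mapping.lookup p m0 = 0" if m0: "m0 \<in> Poly_Mapping.keys p" for m0
  proof -
    have "0 = Poly_Mapping.lookup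
        (\<Sum>m\<in>Poly_Mapping.keys p. Poly_Mapping.single (E m) (Poly_Mapping.lookup p m)) (E m0)"
      by (simp add: sum0)
    also have "\<dots> = (\<Sum>m\<in>Poly_Mapping.keys p. if m = m0 then Poly_Mapping.lookup p m else 0)"
      unfolding lookup_sum by (rule sum.cong) (auto simp: lookup_single when_def E_inj m0)
    also have "\<dots> = Poly_Mapping.lookup p m0" using m0 by simp
    finally show ?thesis by simp
  qed
  then show "p = 0" by (intro poly_mapping_eqI) (metis in_keys_iff lookup_zero)
qed

text \<open>The case needed for \<open>Q\<^sub>n\<close>: some variables together with one more polynomial that a substitution
  fixing these variables turns into a monomial involving a new variable \<open>a\<close>. The exponent at \<open>a\<close>
  recovers the multiplicity of \<open>f\<close>, after which the other exponents recover the multiplicities of the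
  variables.\<close>

lemma alg_independent_insert_variables:
  fixes f :: "('v, 'k::comm_semiring_1) mpoly"
  assumes \<phi>_var: "\<And>i. i \<in> I \<Longrightarrow> \<phi> i = var_poly i"
    and \<phi>_f: "substitute \<phi> f = Poly_Mapping.single e 1"
    and a: "a \<notin> I" "Poly_Mapping.lookup e a \<noteq> 0"
  shows "f \<notin> var_poly ` I" and "alg_independent (insert f (var_poly ` I))"
proof -
  have img: "substitute \<phi> (var_poly i) = Poly_Mapping.single (Poly_Mapping.single i 1) 1" if "i \<in> I" for i
    using \<phi>_var[OF that] substitute_var[of \<phi> i] by (simp only: var_poly_def)
  define \<mu> where "\<mu> g = the_elem (Poly_Mapping.keys (substitute \<phi> g))" for g
  have \<mu>_f: "\<mu> f = e" by (simp add: \<mu>_def \<phi>_f)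
  have \<mu>_var: "\<mu> (var_poly i) = Poly_Mapping.single i 1" if "i \<in> I" for i
    using img[OF that] by (simp add: \<mu>_def)
  show f: "f \<notin> var_poly ` I"
  proof
    assume "f \<in> var_poly ` I"
    then obtain i where i: "i \<in> I" "f = var_poly i" by auto
    then have "Poly_Mapping.lookup e a = 0"
      using \<mu>_f \<mu>_var[OF i(1)] a(1) by (auto simp: lookup_single when_def)
    then show False using a(2) by simp
  qed
  let ?G = "insert f (var_poly ` I)"
  let ?W = "\<lambda>m w. \<Sum>g\<in>Poly_Mapping.keys m. Poly_Mapping.lookup m g * Poly_Mapping.lookup (\<mu> g) w"
  have W: "?W m w = Poly_Mapping.lookup m f * Poly_Mapping.lookup e w +
      (if w \<in> I then Poly_Mapping.lookup m (var_poly w) else 0)"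
    if m: "Poly_Mapping.keys m \<subseteq> ?G" and w: "w \<in> I \<or> w = a" for m w
  proof -
    define H where "H = (Poly_Mapping.keys m \<union> (if w \<in> I then {var_poly w} else {})) - {f}"
    have H: "finite H" "f \<notin> H" "H \<subseteq> var_poly ` I" using m by (auto simp: H_def)
    have "?W m w = (\<Sum>g\<in>insert f H. Poly_Mapping.lookup m g * Poly_Mapping.lookup (\<mu> g) w)"
      by (rule sum.mono_neutral_left) (use H in \<open>auto simp: H_def in_keys_iff\<close>)
    also have "\<dots> = Poly_Mapping.lookup m f * Poly_Mapping.lookup e w +
        (\<Sum>g\<in>H. Poly_Mapping.lookup m g * Poly_Mapping.lookup (\<mu> g) w)"
      using H by (simp add: \<mu>_f)
    also have "(\<Sum>g\<in>H. Poly_Mapping.lookup m g * Poly_Mapping.lookup (\<mu> g) w) =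
        (\<Sum>g\<in>H. if g = var_poly w then Poly_Mapping.lookup m g else 0)"
    proof (rule sum.cong)
      fix g assume "g \<in> H"
      then obtain i where "i \<in> I" "g = var_poly i" using H(3) by auto
      then show "Poly_Mapping.lookup m g * Poly_Mapping.lookup (\<mu> g) w =
          (if g = var_poly w then Poly_Mapping.lookup m g else 0)"
        by (auto simp: \<mu>_var lookup_single when_def)
    qed simp
    also have "\<dots> = (if w \<in> I then Poly_Mapping.lookup m (var_poly w) else 0)"
    proof (cases "w \<in> I")
      case True
      then have "var_poly w \<in> H" using f by (auto simp: H_def)
      then show ?thesis using True H(1) by simp
    next
      case False
      then have "var_poly w \<notin> H" using H(3) by auto
      then show ?thesis using False H(1) by simp
    qed
    finally show ?thesis .
  qed
  show "alg_independent ?G"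
  proof (rule alg_independent_if_monomial_image[of _ \<phi> \<mu>])
    show "substitute \<phi> g = Poly_Mapping.single (\<mu> g) 1" if "g \<in> ?G" for g
      using that by (auto simp: \<mu>_f \<phi>_f \<mu>_var img simp del: substitute_var)
  next
    fix m m' :: "('v, 'k) mpoly \<Rightarrow>\<^sub>0 nat"
    assume m: "Poly_Mapping.keys m \<subseteq> ?G" "Poly_Mapping.keys m' \<subseteq> ?G" and eq: "\<And>w. ?W m w = ?W m' w"
    have mf: "Poly_Mapping.lookup m f = Poly_Mapping.lookup m' f"
      using eq[of a] W[OF m(1), of a] W[OF m(2), of a] a by simp
    moreover have "Poly_Mapping.lookup m (var_poly i) = Poly_Mapping.lookup m' (var_poly i)" if "i \<in> I" for i
      using eq[of i] W[OF m(1), of i] W[OF m(2), of i] that mf by simp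
    ultimately have "Poly_Mapping.lookup m g = Poly_Mapping.lookup m' g" if "g \<in> ?G" for g
      using that by auto
    then show "m = m'"
      using m by (intro poly_mapping_eqI) (metis in_keys_iff subset_eq)
  qed
qed

lemma alg_independent_mono: "alg_independent B \<Longrightarrow> A \<subseteq> B \<Longrightarrow> alg_independent A"
  unfolding alg_independent_def by blast

section \<open>Isotropic subspaces and the index\<close>

text \<open>A single functional lowers the dimension by at most one, because a subspace is spanned by the
  kernel of the functional and any one vector outside that kernel.\<close>

lemma (in finite_dimensional_vector_space) dim_common_kernel:
  assumes U: "subspace U" and "finite C"
    and add: "\<And>c u v. \<phi> c (u + v) = \<phi> c u + (\<phi> c v :: 'a)"
    and scl: "\<And>c a u. \<phi> c (scale a u) = a * \<phi> c u"
  shows "dim U \<le> dim {u \<in> U. \<forall>c\<in>C. \<phi> c u = 0} + card C"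
  using \<open>finite C\<close>
proof (induction C)
  case (insert c C)
  let ?K = "{u \<in> U. \<forall>c\<in>C. \<phi> c u = 0}"
  let ?K' = "{u \<in> U. \<forall>c\<in>insert c C. \<phi> c u = 0}"
  have "dim ?K \<le> dim ?K' + 1"
  proof (cases "\<forall>u\<in>?K. \<phi> c u = 0")
    case True
    then have "?K = ?K'" by auto
    then show ?thesis by simp
  next
    case False
    then obtain u0 where u0: "u0 \<in> ?K" "\<phi> c u0 \<noteq> 0" by auto
    have "?K \<subseteq> span (insert u0 ?K')"
    proof
      fix u assume u: "u \<in> ?K"
      let ?t = "\<phi> c u / \<phi> c u0"
      let ?v = "u + scale (- ?t) u0"
      have "?v \<in> U"
        using u u0 U by (intro subspace_add subspace_scale) auto
      moreover have "\<phi> d ?v = 0" if "d \<in> insert c C" for d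
      proof -
        have "\<phi> d ?v = \<phi> d u + (- ?t) * \<phi> d u0" by (simp only: add scl)
        then show ?thesis using that u u0 by auto
      qed
      ultimately have v: "?v \<in> span (insert u0 ?K')"
        by (intro span_base) auto
      have "?v + scale ?t u0 \<in> span (insert u0 ?K')"
        by (rule span_add[OF v]) (simp add: span_scale span_base)
      also have "?v + scale ?t u0 = u" by simp
      finally show "u \<in> span (insert u0 ?K')" .
    qed
    then have "dim ?K \<le> dim (insert u0 ?K')" by (rule dim_mono)
    then show ?thesis by (auto simp: dim_insert split: if_splits)
  qed
  then show ?case using insert by simp
qed simp

context lie_algebra
begin

lemma bracket_zero_left [simp]: "bracket 0 y = 0"
  using bracket_add_left[of 0 0 y] by simp

lemma bracket_zero_right [simp]: "bracket y 0 = 0"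
  using bracket_add_right[of y 0 0] by simp

lemma bracket_swap: "bracket y z = - bracket z y"
proof -
  have "0 = bracket (y + z) (y + z)" by (simp only: bracket_alternating)
  also have "\<dots> = (bracket y y + bracket z y) + (bracket y z + bracket z z)"
    by (simp only: bracket_add_left bracket_add_right)
  finally have "bracket y z + bracket z y = 0"
    by (simp add: bracket_alternating add.commute)
  then show ?thesis by (simp add: add_eq_0_iff2)
qed

lemma bracket_span_subset:
  assumes Z: "subspace Z" and S: "\<And>a b. a \<in> S \<Longrightarrow> b \<in> S' \<Longrightarrow> bracket a b \<in> Z"
    and "a \<in> span S" "b \<in> span S'"
  shows "bracket a b \<in> Z"
proof -
  have 1: "bracket a b \<in> Z" if "a \<in> S" for a
    using assms(4)
    by (rule span_induct)
      (use Z S that in \<open>auto simp: subspace_def bracket_add_right bracket_scale_right\<close>)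
  show ?thesis
    using assms(3)
    by (rule span_induct)
      (use Z 1 in \<open>auto simp: subspace_def bracket_add_left bracket_scale_left\<close>)
qed

lemma linear_functionalD:
  assumes "Vector_Spaces.linear scale (*) \<xi>"
  shows "\<xi> (u + v) = \<xi> u + \<xi> v" "\<xi> (scale c u) = c * \<xi> u" "\<xi> 0 = 0" "\<xi> (- u) = - \<xi> u"
proof -
  interpret l: Vector_Spaces.linear scale "(*)" \<xi> by fact
  show "\<xi> (u + v) = \<xi> u + \<xi> v" "\<xi> (scale c u) = c * \<xi> u" "\<xi> 0 = 0" "\<xi> (- u) = - \<xi> u"
    by (rule l.add l.scale l.zero l.neg)+
qed

lemma subspace_kernel:
  assumes "Vector_Spaces.linear scale (*) \<xi>"
  shows "subspace {v. \<xi> v = 0}"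
  by (auto simp: subspace_def linear_functionalD[OF assms])

lemma subspace_stabilizer:
  assumes "Vector_Spaces.linear scale (*) \<xi>"
  shows "subspace (stabilizer \<xi>)"
  by (auto simp: subspace_def stabilizer_def bracket_add_left bracket_scale_left
      linear_functionalD[OF assms])

lemma abelian_span:
  assumes "\<And>a b. a \<in> S \<Longrightarrow> b \<in> S \<Longrightarrow> bracket a b = 0"
  shows "abelian_subalgebra (span S)"
  using bracket_span_subset[of "{0}" S S] assms
  by (auto simp: abelian_subalgebra_def)

end

text \<open>A Lie algebra with a fixed basis, over a field of characteristic zero: type \<open>W\<close> has the integers
  \<open>j - i\<close> as structure constants, and an alternating Poisson bracket is deduced from an
  antisymmetric one.\<close>

locale based_lie_algebra = lie_algebra scale bracket
  for scale :: "'k::field_char_0 \<Rightarrow> 'a::ab_group_add \<Rightarrow> 'a" and bracket :: "'a \<Rightarrow> 'a \<Rightarrow> 'a" +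
  fixes n :: nat and x :: "nat \<Rightarrow> 'a"
  assumes is_basis: "basis n x"
begin

sublocale finite_dimensional_vector_space scale "x ` {1..n}"
  by unfold_locales (use is_basis in \<open>auto simp: basis_def\<close>)

lemma inj_x: "inj_on x {1..n}"
  using is_basis by (simp add: basis_def)

lemma dim_whole_space: "dim (UNIV :: 'a set) = n"
  using inj_x by (simp add: card_image)

lemma dim_span_x:
  assumes "I \<subseteq> {1..n}"
  shows "dim (span (x ` I)) = card I"
proof -
  have "independent (x ` I)"
    using independent_Basis by (rule independent_mono) (use assms in auto)
  moreover have "card (x ` I) = card I"
    using inj_x assms by (intro card_image) (rule inj_on_subset)
  ultimately show ?thesis using dim_span_eq_card_independent by metis
qed

text \<open>Complete a basis \<open>B\<close> of \<open>P\<close> to a basis of \<open>L\<close> by \<open>n - dim P\<close> further vectors \<open>c\<close>. An element of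
  \<open>P\<close> pairs to zero with \<open>P\<close> anyway; if it also pairs to zero with all \<open>c\<close>, it lies in \<open>L(\<xi>)\<close>. So
  \<open>n - dim P\<close> functionals cut \<open>P\<close> down to \<open>P \<inter> L(\<xi>)\<close>.\<close>

lemma isotropic_dim_bound:
  assumes \<xi>: "Vector_Spaces.linear scale (*) \<xi>" and P: "subspace P"
    and iso: "\<And>p q. p \<in> P \<Longrightarrow> q \<in> P \<Longrightarrow> \<xi> (bracket p q) = 0"
  shows "2 * dim P \<le> n + dim (P \<inter> stabilizer \<xi>)"
proof -
  obtain B where B: "B \<subseteq> P" "independent B" "P \<subseteq> span B" "card B = dim P"
    using basis_exists[of P] by blast
  let ?E = "extend_basis B"
  have E: "independent ?E" "span ?E = UNIV" "B \<subseteq> ?E"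
    using B(2) by (auto simp: independent_extend_basis span_extend_basis extend_basis_superset)
  have fin: "finite ?E" using E(1) by (rule finiteI_independent)
  have "card ?E = n"
    using dim_eq_card[of ?E UNIV] E(1,2) dim_whole_space by simp
  then have card: "card (?E - B) + dim P = n"
    using fin E(3) B(4) by (metis card_Diff_subset card_mono finite_subset le_add_diff_inverse2)
  have "dim P \<le> dim {u \<in> P. \<forall>c\<in>?E - B. \<xi> (bracket u c) = 0} + card (?E - B)"
    using P fin
    by (intro dim_common_kernel)
      (auto simp: bracket_add_left bracket_scale_left linear_functionalD[OF \<xi>])
  moreover have "{u \<in> P. \<forall>c\<in>?E - B. \<xi> (bracket u c) = 0} \<subseteq> P \<inter> stabilizer \<xi>"
  proof
    fix u assume u: "u \<in> {u \<in> P. \<forall>c\<in>?E - B. \<xi> (bracket u c) = 0}"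
    have on_E: "\<xi> (bracket u c) = 0" if "c \<in> ?E" for c
      using u that iso B(1) by (cases "c \<in> B") auto
    have "bracket u y \<in> {v. \<xi> v = 0}" for y
      by (rule bracket_span_subset[of _ "{u}" ?E])
        (auto simp: subspace_kernel[OF \<xi>] E(2) on_E intro: span_base)
    then show "u \<in> P \<inter> stabilizer \<xi>" using u by (auto simp: stabilizer_def)
  qed
  then have "dim {u \<in> P. \<forall>c\<in>?E - B. \<xi> (bracket u c) = 0} \<le> dim (P \<inter> stabilizer \<xi>)"
    by (rule dim_subset)
  ultimately show ?thesis using card by linarith
qed

lemma abelian_dim_bound:
  assumes "Vector_Spaces.linear scale (*) \<xi>" "abelian_subalgebra P"
  shows "2 * dim P \<le> n + dim (P \<inter> stabilizer \<xi>)"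
  using assms
  by (intro isotropic_dim_bound) (auto simp: abelian_subalgebra_def linear_functionalD(3))

text \<open>\<open>alpha\<close> is a maximum over a set of naturals, which means something only because the dimensions
  are bounded.\<close>

lemma alpha_eqI:
  assumes "abelian_subalgebra P" "dim P = p" "\<And>P'. abelian_subalgebra P' \<Longrightarrow> dim P' \<le> p"
  shows "alpha = p"
  unfolding alpha_def
proof (rule Max_eqI)
  have "{dim P |P. abelian_subalgebra P} \<subseteq> {..p}" using assms(3) by auto
  then show "finite {dim P |P. abelian_subalgebra P}" by (rule finite_subset) simp
qed (use assms in auto)

lemma index_eqI:
  assumes "Vector_Spaces.linear scale (*) \<xi>" "dim (stabilizer \<xi>) \<le> d"
    and "\<And>\<eta>. Vector_Spaces.linear scale (*) \<eta> \<Longrightarrow> d \<le> dim (stabilizer \<eta>)"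
  shows "index = d"
  unfolding index_def
proof (rule Least_equality)
  show "\<exists>\<xi>. Vector_Spaces.linear scale (*) \<xi> \<and> d = dim (stabilizer \<xi>)"
    using assms by (metis le_antisym)
qed (use assms(3) in auto)

text \<open>The stabilizer of \<open>\<xi>\<close> is as small as the abelian \<open>P\<close> permits, hence of minimal dimension
  \<open>2 dim P - n\<close>; read in the other direction, \<open>P\<close> is as large as \<open>\<xi>\<close> permits.\<close>

lemma magic_number_alpha_of_abelian_polarization:
  assumes \<xi>: "Vector_Spaces.linear scale (*) \<xi>" and P: "abelian_subalgebra P"
    and small: "dim (stabilizer \<xi>) + n \<le> 2 * dim P"
  shows "magic_number = dim P" and "alpha = dim P"
proof -
  have le: "2 * dim P' \<le> n + dim (stabilizer \<eta>)"
    if "Vector_Spaces.linear scale (*) \<eta>" "abelian_subalgebra P'" for \<eta> P'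
    using abelian_dim_bound[OF that] dim_subset[of "P' \<inter> stabilizer \<eta>" "stabilizer \<eta>"] by simp
  have "index = 2 * dim P - n"
    by (rule index_eqI[OF \<xi>]) (use small le[OF _ P] in force)+
  then show "magic_number = dim P"
    using small unfolding magic_number_def dim_whole_space by simp
  show "alpha = dim P"
    by (rule alpha_eqI[OF P refl]) (use small le[OF \<xi>] in force)
qed


section \<open>Coordinates and the stabilizer of a coordinate functional\<close>

definition coord :: "nat \<Rightarrow> 'a \<Rightarrow> 'k" where
  "coord i v = representation (x ` {1..n}) v (x i)"

lemma coord_x:
  assumes "i \<in> {1..n}" "j \<in> {1..n}"
  shows "coord i (x j) = (if i = j then 1 else 0)"
proof -
  have "representation (x ` {1..n}) (x j) = (\<lambda>v. if v = x j then 1 else 0)"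
    by (rule representation_basis) (use assms independent_Basis in auto)
  then show ?thesis
    using inj_onD[OF inj_x _ assms] by (auto simp: coord_def)
qed

lemma coord_add: "coord i (u + v) = coord i u + coord i v"
  unfolding coord_def using span_Basis by (subst representation_add[OF independent_Basis]) auto

lemma coord_scale: "coord i (scale c v) = c * coord i v"
  unfolding coord_def using span_Basis by (subst representation_scale[OF independent_Basis]) auto

lemma coord_neg: "coord i (- v) = - coord i v"
  unfolding coord_def using span_Basis by (subst representation_neg[OF independent_Basis]) auto

lemma coord_zero [simp]: "coord i 0 = 0"
  by (simp add: coord_def representation_zero)

lemma linear_coord: "Vector_Spaces.linear scale (*) (coord i)"
  unfolding Vector_Spaces.linear_iff
proof (intro conjI allI)
  show "vector_space scale" by (fact vector_space_axioms)
  show "vector_space ((*) :: 'k \<Rightarrow> 'k \<Rightarrow> 'k)"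
    by unfold_locales (auto simp: algebra_simps)
qed (simp_all add: coord_add coord_scale)

lemma coord_sum: "coord i (\<Sum>j\<in>J. f j) = (\<Sum>j\<in>J. coord i (f j))"
  by (induction J rule: infinite_finite_induct) (simp_all add: coord_add)

lemma bracket_sum_left: "bracket (\<Sum>j\<in>J. f j) y = (\<Sum>j\<in>J. bracket (f j) y)"
  by (induction J rule: infinite_finite_induct) (simp_all add: bracket_add_left)

lemma bracket_sum_right: "bracket y (\<Sum>j\<in>J. f j) = (\<Sum>j\<in>J. bracket y (f j))"
  by (induction J rule: infinite_finite_induct) (simp_all add: bracket_add_right)

lemma expansion: "v = (\<Sum>i=1..n. scale (coord i v) (x i))"
proof -
  have "v = (\<Sum>b\<in>x ` {1..n}. scale (representation (x ` {1..n}) v b) b)"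
    by (rule sum_representation_eq[symmetric]) (use independent_Basis span_Basis in auto)
  then show ?thesis
    using inj_x by (simp add: sum.reindex coord_def)
qed

lemma in_span_x_if_coords_vanish:
  assumes "J \<subseteq> {1..n}" "\<And>i. i \<in> {1..n} - J \<Longrightarrow> coord i v = 0"
  shows "v \<in> span (x ` J)"
proof -
  have "v = (\<Sum>i\<in>J. scale (coord i v) (x i))"
    by (subst expansion, rule sum.mono_neutral_right) (use assms in auto)
  also have "\<dots> \<in> span (x ` J)"
    by (intro span_sum span_scale span_base) auto
  finally show ?thesis .
qed

text \<open>If \<open>x\<^sub>j\<close> pairs nontrivially with \<open>x\<^sub>i\<close> and with no other basis vector, then pairing with \<open>x\<^sub>j\<close>
  reads off the \<open>i\<close>-th coordinate, which must vanish on the stabilizer.\<close>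

lemma stabilizer_coord_subset:
  assumes J: "J \<subseteq> {1..n}"
    and partner: "\<And>i. i \<in> {1..n} - J \<Longrightarrow> \<exists>j. coord n (bracket (x i) (x j)) \<noteq> 0 \<and>
        (\<forall>k\<in>{1..n} - {i}. coord n (bracket (x k) (x j)) = 0)"
  shows "stabilizer (coord n) \<subseteq> span (x ` J)"
proof
  fix v assume v: "v \<in> stabilizer (coord n)"
  have "coord i v = 0" if i: "i \<in> {1..n} - J" for i
  proof -
    obtain j where j: "coord n (bracket (x i) (x j)) \<noteq> 0"
      "\<And>k. k \<in> {1..n} - {i} \<Longrightarrow> coord n (bracket (x k) (x j)) = 0"
      using partner[OF i] by blast
    have "0 = coord n (bracket v (x j))"
      using v by (simp add: stabilizer_def)
    also have "\<dots> = (\<Sum>k=1..n. coord k v * coord n (bracket (x k) (x j)))"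
      by (subst expansion[of v])
        (simp add: bracket_sum_left coord_sum bracket_scale_left coord_scale)
    also have "\<dots> = coord i v * coord n (bracket (x i) (x j))"
      using i j(2) by (subst sum.remove[of _ i]) auto
    finally show ?thesis using j(1) by simp
  qed
  then show "v \<in> span (x ` J)" using J by (intro in_span_x_if_coords_vanish)
qed

lemma dim_stabilizer_coord_le:
  assumes "J \<subseteq> {1..n}"
    and "\<And>i. i \<in> {1..n} - J \<Longrightarrow> \<exists>j. coord n (bracket (x i) (x j)) \<noteq> 0 \<and>
        (\<forall>k\<in>{1..n} - {i}. coord n (bracket (x k) (x j)) = 0)"
  shows "dim (stabilizer (coord n)) \<le> card J"
  using dim_subset[OF stabilizer_coord_subset[OF assms]] dim_span_x[OF assms(1)] by simp

lemma bracket_x_zero_if_ordered: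
  assumes "\<And>i j. i \<in> I \<Longrightarrow> j \<in> I \<Longrightarrow> i < j \<Longrightarrow> bracket (x i) (x j) = 0" "i \<in> I" "j \<in> I"
  shows "bracket (x i) (x j) = 0"
  using assms bracket_swap[of "x i" "x j"]
  by (cases i j rule: linorder_cases) (auto simp: bracket_alternating)

text \<open>The types list only the brackets with \<open>i < j\<close>. A formula for their last coordinates extends to all
  pairs if it is itself antisymmetric, since in characteristic zero it then vanishes on the
  diagonal.\<close>

lemma coord_bracket_if_ordered:
  assumes ordered: "\<And>i j. 1 \<le> i \<Longrightarrow> i < j \<Longrightarrow> j \<le> n \<Longrightarrow> coord n (bracket (x i) (x j)) = \<omega> i j"
    and alt: "\<And>i j. \<omega> j i = - \<omega> i j"
    and "i \<in> {1..n}" "j \<in> {1..n}"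
  shows "coord n (bracket (x i) (x j)) = \<omega> i j"
proof (cases i j rule: linorder_cases)
  case less
  then show ?thesis using ordered assms(3,4) by simp
next
  case equal
  then show ?thesis using alt[of i i] by (simp add: bracket_alternating)
next
  case greater
  have "coord n (bracket (x i) (x j)) = - coord n (bracket (x j) (x i))"
    by (subst bracket_swap) (rule coord_neg)
  also have "\<dots> = - \<omega> j i" using ordered[of j i] greater assms(3,4) by simp
  also have "\<dots> = \<omega> i j" by (simp add: alt[of j i])
  finally show ?thesis .
qed

lemma CP_of_index_sets:
  assumes I: "I \<subseteq> {1..n}" and J: "J \<subseteq> {1..n}"
    and comm: "\<And>i j. i \<in> I \<Longrightarrow> j \<in> I \<Longrightarrow> i < j \<Longrightarrow> bracket (x i) (x j) = 0"
    and partner: "\<And>i. i \<in> {1..n} - J \<Longrightarrow> \<exists>j. coord n (bracket (x i) (x j)) \<noteq> 0 \<and>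
        (\<forall>k\<in>{1..n} - {i}. coord n (bracket (x k) (x j)) = 0)"
    and card: "card J + n \<le> 2 * card I"
  shows "CP (span (x ` I))" and "magic_number = card I" and "alpha = card I"
proof -
  have P: "abelian_subalgebra (span (x ` I))"
    by (rule abelian_span) (use bracket_x_zero_if_ordered[of I] comm in auto)
  have small: "dim (stabilizer (coord n)) + n \<le> 2 * dim (span (x ` I))"
    using dim_stabilizer_coord_le[OF J partner] card dim_span_x[OF I] by simp
  note result = magic_number_alpha_of_abelian_polarization[OF linear_coord P small]
  show "magic_number = card I" "alpha = card I" "CP (span (x ` I))"
    using result dim_span_x[OF I] P by (simp_all add: CP_def)
qed

section \<open>Complete Poisson commutative subalgebras\<close>

lemma linear_form_x:
  assumes "i \<in> {1..n}"
  shows "linear_form n x (x i) = var_poly i"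
proof -
  have "linear_form n x (x i) = (\<Sum>j=1..n. const_poly (coord j (x i)) * var_poly j)"
    by (simp add: linear_form_def coord_def)
  also have "\<dots> = (\<Sum>j=1..n. if j = i then var_poly j else 0)"
    by (rule sum.cong) (use assms in \<open>auto simp: coord_x\<close>)
  finally show ?thesis using assms by simp
qed

lemma linear_form_scale: "linear_form n x (scale c v) = const_poly c * linear_form n x v"
  unfolding linear_form_def coord_def[symmetric]
  by (simp add: coord_scale const_poly_mult sum_distrib_left mult.assoc)

lemma linear_form_zero [simp]: "linear_form n x 0 = 0"
  using linear_form_scale[of 0 0] by simp

lemma linear_form_neg: "linear_form n x (- v) = - linear_form n x v"
proof -
  have "const_poly (- c) = - (const_poly c :: (nat, 'k) mpoly)" for c
    by (simp add: const_poly_def single_uminus)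
  then show ?thesis
    unfolding linear_form_def coord_def[symmetric] by (simp add: coord_neg sum_negf)
qed

lemma poisson_swap: "poisson n x f g = - poisson n x g f"
proof -
  have "poisson n x f g = (\<Sum>i=1..n. \<Sum>j=1..n.
      - (linear_form n x (bracket (x j) (x i)) * partial j g * partial i f))"
    unfolding poisson_def
  proof (intro sum.cong refl)
    fix i j
    show "linear_form n x (bracket (x i) (x j)) * partial i f * partial j g =
        - (linear_form n x (bracket (x j) (x i)) * partial j g * partial i f)"
      by (subst bracket_swap) (simp add: linear_form_neg mult_ac)
  qed
  also have "\<dots> = - poisson n x g f"
    unfolding poisson_def by (subst sum.swap) (simp add: sum_negf)
  finally show ?thesis .
qed

lemma poisson_add_left: "poisson n x (f + g) h = poisson n x f h + poisson n x g h"
  by (simp add: poisson_def partial_add algebra_simps sum.distrib)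

lemma poisson_mult_left: "poisson n x (f * g) h = f * poisson n x g h + g * poisson n x f h"
  by (simp add: poisson_def partial_mult algebra_simps sum.distrib sum_distrib_left)

lemma poisson_const_left [simp]: "poisson n x (const_poly c) h = 0"
  by (simp add: poisson_def)

lemma poisson_zero_left [simp]: "poisson n x 0 h = 0"
  by (simp add: poisson_def)

lemma poisson_sum_left: "poisson n x (\<Sum>i\<in>I. f i) h = (\<Sum>i\<in>I. poisson n x (f i) h)"
  by (induction I rule: infinite_finite_induct) (simp_all add: poisson_add_left)

lemma poisson_self [simp]: "poisson n x f f = 0"
proof -
  have "Poly_Mapping.lookup (poisson n x f f) m = - Poly_Mapping.lookup (poisson n x f f) m" for m
    using poisson_swap[of f f] by (metis lookup_uminus)
  then show ?thesis by (intro poly_mapping_eqI) simp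
qed

lemma poisson_var:
  assumes "i \<in> {1..n}" "j \<in> {1..n}"
  shows "poisson n x (var_poly i) (var_poly j) = linear_form n x (bracket (x i) (x j))"
proof -
  have "poisson n x (var_poly i) (var_poly j) =
      (\<Sum>a=1..n. \<Sum>b=1..n. if b = j then if a = i then linear_form n x (bracket (x a) (x b)) else 0 else 0)"
    unfolding poisson_def by (intro sum.cong refl) (simp add: partial_var)
  then show ?thesis using assms by simp
qed

text \<open>The Poisson bracket with \<open>h\<close> is a derivation, so it vanishes on a subalgebra as soon as it
  vanishes on generators.\<close>

lemma poisson_zero_on_hull:
  assumes "f \<in> unital_subalgebra hull G" "\<And>g. g \<in> G \<Longrightarrow> poisson n x g h = 0"
  shows "poisson n x f h = 0"
  using assms(1)
  by (induction f rule: hull_induct_subalgebra) (simp_all add: assms(2) poisson_add_left poisson_mult_left)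

lemma milovanov_of_generators:
  assumes "finite G" "G \<subseteq> sym_algebra n" "alg_independent G" "card G = magic_number"
    and deg: "\<And>g. g \<in> G \<Longrightarrow> degree_le 2 g"
    and comm: "\<And>f g. f \<in> G \<Longrightarrow> g \<in> G \<Longrightarrow> poisson n x f g = 0"
  shows "milovanov n x"
proof -
  let ?A = "unital_subalgebra hull G"
  have "poisson n x f g = 0" if f: "f \<in> ?A" and g: "g \<in> ?A" for f g
  proof (rule poisson_zero_on_hull[OF f])
    fix h assume h: "h \<in> G"
    have "poisson n x g h = 0"
      by (rule poisson_zero_on_hull[OF g]) (use comm h in auto)
    then show "poisson n x h g = 0" using poisson_swap[of h g] by simp
  qed
  moreover have "?A \<subseteq> sym_algebra n"
    by (rule hull_minimal) (use assms(2) unital_subalgebra_sym_algebra in auto)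
  moreover have "has_trdeg ?A magic_number"
    using has_trdeg_hull[OF assms(1,3)] assms(4) by simp
  ultimately have "complete_poisson_commutative n x ?A"
    by (auto simp: complete_poisson_commutative_def poisson_commutative_def unital_subalgebra_hull)
  then show ?thesis using deg unfolding milovanov_def by blast
qed

lemma inj_var_poly: "inj (var_poly :: nat \<Rightarrow> (nat, 'k) mpoly)"
  by (rule injI) simp

text \<open>Milovanov's conjecture is immediate from a commutative polarization spanned by basis vectors:
  the corresponding variables are algebraically independent, and there are \<open>c(L)\<close> of them.\<close>

lemma milovanov_of_commuting_variables:
  assumes I: "I \<subseteq> {1..n}" and card: "card I = magic_number"
    and comm: "\<And>i j. i \<in> I \<Longrightarrow> j \<in> I \<Longrightarrow> i < j \<Longrightarrow> bracket (x i) (x j) = 0"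
  shows "milovanov n x"
proof (rule milovanov_of_generators)
  let ?G = "var_poly ` I :: (nat, 'k) mpoly set"
  show "finite ?G" using I finite_subset by blast
  show "?G \<subseteq> sym_algebra n" using I by (auto simp: sym_algebra_def variables_var)
  \<comment> \<open>The variables in \<open>S(L)\<close> are numbered from 1, so the variable 0 can serve as the additional element.\<close>
  have "substitute var_poly (var_poly 0) = (Poly_Mapping.single (Poly_Mapping.single 0 1) 1 :: (nat, 'k) mpoly)"
    unfolding substitute_var by (simp add: var_poly_def)
  then have "alg_independent (insert (var_poly 0) ?G)"
    by (rule alg_independent_insert_variables(2)[rotated, where a = 0]) (use I in auto)
  then show "alg_independent ?G" by (rule alg_independent_mono) auto
  show "card ?G = magic_number"
    using card by (simp add: card_image[OF inj_on_subset[OF inj_var_poly]])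
  show "degree_le 2 g" if "g \<in> ?G" for g
  proof -
    have "degree_le 2 (var_poly i :: (nat, 'k) mpoly)" for i
      by (rule degree_le_mono[OF degree_le_var]) simp
    then show ?thesis using that by auto
  qed
  show "poisson n x f g = 0" if fg: "f \<in> ?G" "g \<in> ?G" for f g
  proof -
    obtain i j where ij: "f = var_poly i" "i \<in> I" "g = var_poly j" "j \<in> I" using fg by auto
    have "poisson n x f g = linear_form n x (bracket (x i) (x j))"
      unfolding ij(1,3) by (rule poisson_var) (use ij I in auto)
    also have "bracket (x i) (x j) = 0"
      by (rule bracket_x_zero_if_ordered[of I]) (use comm ij in auto)
    finally show ?thesis by simp
  qed
qed

section \<open>The types \<open>L\<close>, \<open>R\<close> and \<open>W\<close>\<close>

text \<open>The common argument for \<open>L\<^sub>n\<close>, \<open>R\<^sub>n\<close> and \<open>W\<^sub>n\<close>: the \<open>x\<^sub>i\<close> with \<open>i \<in> I\<close> span the commutative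
  polarization, and the \<open>x\<^sub>j\<close> with \<open>j \<in> J\<close> contain the stabilizer of the last coordinate in their
  span.\<close>

lemma polarized_by_index_sets:
  assumes I: "I \<subseteq> {1..n}" and J: "J \<subseteq> {1..n}"
    and comm: "\<And>i j. i \<in> I \<Longrightarrow> j \<in> I \<Longrightarrow> i < j \<Longrightarrow> bracket (x i) (x j) = 0"
    and partner: "\<And>i. i \<in> {1..n} - J \<Longrightarrow> \<exists>j. coord n (bracket (x i) (x j)) \<noteq> 0 \<and>
        (\<forall>k\<in>{1..n} - {i}. coord n (bracket (x k) (x j)) = 0)"
    and card: "card J + n \<le> 2 * card I"
  shows "(\<exists>P. CP P) \<and> alpha = card I \<and> milovanov n x"
proof -
  note polarization = CP_of_index_sets[OF assms]
  have "milovanov n x"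
    by (rule milovanov_of_commuting_variables[OF I polarization(2)[symmetric] comm])
  then show ?thesis using polarization(1,3) by blast
qed

text \<open>The last coordinate pairs \<open>x\<^sub>1\<close> with \<open>x\<^sub>n\<^sub>-\<^sub>1\<close> and nothing else, so the index is at most \<open>n - 2\<close>,
  matching the abelian ideal of codimension one.\<close>

lemma type_L_polarized:
  assumes "type_L n x"
  shows "(\<exists>P. CP P) \<and> alpha = n - 1 \<and> milovanov n x"
proof -
  have n: "n \<ge> 3" and br: "\<And>i j. 1 \<le> i \<Longrightarrow> i < j \<Longrightarrow> j \<le> n \<Longrightarrow>
      bracket (x i) (x j) = (if i = 1 \<and> j + 1 \<le> n then x (j + 1) else 0)"
    using assms by (auto simp: type_L_def)
  define \<omega> :: "nat \<Rightarrow> nat \<Rightarrow> 'k"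
    where "\<omega> i j = of_bool (i = 1 \<and> j = n - 1) - of_bool (j = 1 \<and> i = n - 1)" for i j
  have pair: "coord n (bracket (x i) (x j)) = \<omega> i j" if "i \<in> {1..n}" "j \<in> {1..n}" for i j
  proof (rule coord_bracket_if_ordered[OF _ _ that])
    fix i j assume ij: "1 \<le> i" "i < j" "j \<le> n"
    show "coord n (bracket (x i) (x j)) = \<omega> i j"
      unfolding br[OF ij] using ij n by (auto simp: coord_x \<omega>_def)
  qed (simp add: \<omega>_def)
  have "(\<exists>P. CP P) \<and> alpha = card {2..n} \<and> milovanov n x"
  proof (rule polarized_by_index_sets[of _ "{2..n-2} \<union> {n}"])
    fix i assume "i \<in> {1..n} - ({2..n-2} \<union> {n})"
    then have "i = 1 \<or> i = n - 1" using n by auto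
    then show "\<exists>j. coord n (bracket (x i) (x j)) \<noteq> 0 \<and>
        (\<forall>k\<in>{1..n} - {i}. coord n (bracket (x k) (x j)) = 0)"
      using n by (intro exI[of _ "n - i"]) (auto simp: pair \<omega>_def of_bool_def split: if_splits)
  qed (use n in \<open>auto simp: br card_insert_if\<close>)
  then show ?thesis by simp
qed

text \<open>The last coordinate pairs \<open>x\<^sub>1\<close> with \<open>x\<^sub>n\<^sub>-\<^sub>1\<close> and \<open>x\<^sub>2\<close> with \<open>x\<^sub>n\<^sub>-\<^sub>2\<close>; these are four different
  vectors because \<open>n \<ge> 5\<close>. So the index is at most \<open>n - 4\<close>, matching the abelian ideal of codimension
  two.\<close>

lemma type_R_polarized:
  assumes "type_R n x"
  shows "(\<exists>P. CP P) \<and> alpha = n - 2 \<and> milovanov n x"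
proof -
  have n: "n \<ge> 5" and br: "\<And>i j. 1 \<le> i \<Longrightarrow> i < j \<Longrightarrow> j \<le> n \<Longrightarrow>
      bracket (x i) (x j) = (if i = 1 \<and> j + 1 \<le> n then x (j + 1)
        else if i = 2 \<and> j + 2 \<le> n then x (j + 2) else 0)"
    using assms by (auto simp: type_R_def)
  define \<omega> :: "nat \<Rightarrow> nat \<Rightarrow> 'k"
    where "\<omega> i j = of_bool (i \<le> 2 \<and> i + j = n) - of_bool (j \<le> 2 \<and> i + j = n)" for i j
  have pair: "coord n (bracket (x i) (x j)) = \<omega> i j" if "i \<in> {1..n}" "j \<in> {1..n}" for i j
  proof (rule coord_bracket_if_ordered[OF _ _ that])
    fix i j assume ij: "1 \<le> i" "i < j" "j \<le> n"
    show "coord n (bracket (x i) (x j)) = \<omega> i j"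
      unfolding br[OF ij] using ij n by (simp add: coord_x \<omega>_def of_bool_def)
  qed (simp add: \<omega>_def add.commute)
  have "(\<exists>P. CP P) \<and> alpha = card {3..n} \<and> milovanov n x"
  proof (rule polarized_by_index_sets[of _ "{3..n-3} \<union> {n}"])
    fix i assume "i \<in> {1..n} - ({3..n-3} \<union> {n})"
    then have "i \<in> {1..n}" "i \<le> 2 \<or> n - i \<le> 2" "i \<noteq> n" using n by auto
    then show "\<exists>j. coord n (bracket (x i) (x j)) \<noteq> 0 \<and>
        (\<forall>k\<in>{1..n} - {i}. coord n (bracket (x k) (x j)) = 0)"
      using n by (intro exI[of _ "n - i"]) (auto simp: pair \<omega>_def of_bool_def split: if_splits)
  qed (use n in \<open>auto simp: br card_insert_if\<close>)
  then show ?thesis by simp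
qed

text \<open>The last coordinate pairs \<open>x\<^sub>i\<close> with \<open>x\<^sub>n\<^sub>-\<^sub>i\<close>. Only \<open>x\<^sub>n\<close> and, for even \<open>n\<close>, the middle vector have
  no partner other than themselves, so the index is at most 1 for odd \<open>n\<close> and 2 for even \<open>n\<close>.
  The upper half of the basis commutes because any two different indices in it sum to more than \<open>n\<close>.\<close>

lemma type_W_polarized:
  assumes "type_W n x"
  shows "(\<exists>P. CP P) \<and> alpha = (n + 2) div 2 \<and> milovanov n x"
proof -
  have n: "n \<ge> 1" and br: "\<And>i j. 1 \<le> i \<Longrightarrow> i < j \<Longrightarrow> j \<le> n \<Longrightarrow>
      bracket (x i) (x j) = (if i + j \<le> n then scale (of_nat (j - i)) (x (i + j)) else 0)"
    using assms by (auto simp: type_W_def)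
  define \<omega> :: "nat \<Rightarrow> nat \<Rightarrow> 'k"
    where "\<omega> i j = (if i + j = n then of_nat j - of_nat i else 0)" for i j
  have pair: "coord n (bracket (x i) (x j)) = \<omega> i j" if "i \<in> {1..n}" "j \<in> {1..n}" for i j
  proof (rule coord_bracket_if_ordered[OF _ _ that])
    fix i j assume ij: "1 \<le> i" "i < j" "j \<le> n"
    show "coord n (bracket (x i) (x j)) = \<omega> i j"
      unfolding br[OF ij] using ij n by (auto simp: coord_x coord_scale \<omega>_def of_nat_diff)
  qed (simp add: \<omega>_def add.commute)
  let ?J = "insert n (if even n then {n div 2} else {})"
  have "(\<exists>P. CP P) \<and> alpha = card {(n + 1) div 2..n} \<and> milovanov n x"
  proof (rule polarized_by_index_sets[of _ ?J])
    show "{(n + 1) div 2..n} \<subseteq> {1..n}" using n by auto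
    show "?J \<subseteq> {1..n}" using n by (auto elim!: evenE)
    show "card ?J + n \<le> 2 * card {(n + 1) div 2..n}"
      using n by (auto simp: card_insert_if elim!: evenE oddE)
    show "bracket (x i) (x j) = 0"
      if "i \<in> {(n + 1) div 2..n}" "j \<in> {(n + 1) div 2..n}" "i < j" for i j
      using that n br[of i j] by auto
    fix i assume "i \<in> {1..n} - ?J"
    then have i: "i \<in> {1..n}" "n - i \<in> {1..n}" "i + (n - i) = n" "i \<noteq> n - i"
      by (auto split: if_splits) presburger
    show "\<exists>j. coord n (bracket (x i) (x j)) \<noteq> 0 \<and>
        (\<forall>k\<in>{1..n} - {i}. coord n (bracket (x k) (x j)) = 0)"
    proof (intro exI conjI ballI)
      have "coord n (bracket (x i) (x (n - i))) = of_nat (n - i) - of_nat i"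
        unfolding pair[OF i(1,2)] \<omega>_def i(3) by simp
      moreover have "(of_nat (n - i) :: 'k) \<noteq> of_nat i" using i(4) by (simp only: of_nat_eq_iff)
      ultimately show "coord n (bracket (x i) (x (n - i))) \<noteq> 0" by simp
      show "coord n (bracket (x k) (x (n - i))) = 0" if "k \<in> {1..n} - {i}" for k
        using that i by (subst pair) (auto simp: \<omega>_def)
    qed
  qed
  moreover have "card {(n + 1) div 2..n} = (n + 2) div 2"
    by (cases "even n") (auto elim!: evenE oddE)
  ultimately show ?thesis by simp
qed

section \<open>The type \<open>Q\<close>\<close>

context
  fixes q :: nat
  assumes Q: "type_Q n x" and n: "n = 2 * q"
begin

lemma Q_pos: "q \<ge> 1"
  using Q n by (auto simp: type_Q_def)

lemma bracket_Q:
  assumes "1 \<le> i" "i < j" "j \<le> n"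
  shows "bracket (x i) (x j) = (if i = 1 \<and> j + 2 \<le> n then x (j + 1)
      else if 2 \<le> i \<and> i + j = n + 1 then scale ((- 1) ^ (i + 1)) (x n) else 0)"
  using Q assms by (auto simp: type_Q_def)

lemma coord_bracket_Q:
  assumes "i \<in> {1..n}" "j \<in> {1..n}"
  shows "coord n (bracket (x i) (x j)) = (if 2 \<le> i \<and> 2 \<le> j \<and> i + j = n + 1 then (- 1) ^ (i + 1) else 0)"
proof (rule coord_bracket_if_ordered[OF _ _ assms])
  fix i j assume ij: "1 \<le> i" "i < j" "j \<le> n"
  show "coord n (bracket (x i) (x j)) = (if 2 \<le> i \<and> 2 \<le> j \<and> i + j = n + 1 then (- 1) ^ (i + 1) else 0)"
    unfolding bracket_Q[OF ij] using ij by (simp add: coord_x coord_scale coord_neg)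
next
  fix i j :: nat
  have "(- 1) ^ (j + 1) = - ((- 1) ^ (i + 1) :: 'k)" if "i + j = n + 1"
  proof (cases "even i")
    case True
    then have "odd j" using that n by presburger
    then show ?thesis using True by simp
  next
    case False
    then have "even j" using that n by presburger
    then show ?thesis using False by simp
  qed
  then show "(if 2 \<le> j \<and> 2 \<le> i \<and> j + i = n + 1 then (- 1) ^ (j + 1) else 0) =
      - (if 2 \<le> i \<and> 2 \<le> j \<and> i + j = n + 1 then (- 1) ^ (i + 1) else 0 :: 'k)"
    by (auto simp: add.commute)
qed

lemma commuting_Q:
  assumes "i \<in> {q + 1..n}" "j \<in> {q + 1..n}"
  shows "bracket (x i) (x j) = 0"
proof (rule bracket_x_zero_if_ordered[OF _ assms])
  fix i j assume "i \<in> {q + 1..n}" "j \<in> {q + 1..n}" "i < j"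
  then show "bracket (x i) (x j) = 0" using n Q_pos by (simp add: bracket_Q)
qed

lemma central_Q: "bracket v (x n) = 0"
proof -
  have "bracket (x i) (x n) = 0" if "i \<in> {1..n}" for i
    using that Q_pos n by (cases "i = n") (auto simp: bracket_Q bracket_alternating)
  then show ?thesis
    by (subst expansion[of v]) (simp add: bracket_sum_left bracket_scale_left)
qed

text \<open>The last coordinate pairs \<open>x\<^sub>i\<close> with \<open>x\<^sub>n\<^sub>+\<^sub>1\<^sub>-\<^sub>i\<close> for \<open>2 \<le> i \<le> n - 1\<close>.\<close>

lemma stabilizer_coord_Q: "stabilizer (coord n) \<subseteq> span (x ` {1, n})"
proof (rule stabilizer_coord_subset)
  show "{1, n} \<subseteq> {1..n}" using Q_pos n by auto
  fix i assume i: "i \<in> {1..n} - {1, n}"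
  show "\<exists>j. coord n (bracket (x i) (x j)) \<noteq> 0 \<and> (\<forall>k\<in>{1..n} - {i}. coord n (bracket (x k) (x j)) = 0)"
  proof (intro exI conjI ballI)
    show "coord n (bracket (x i) (x (n + 1 - i))) \<noteq> 0"
      using i by (subst coord_bracket_Q) auto
    show "coord n (bracket (x k) (x (n + 1 - i))) = 0" if "k \<in> {1..n} - {i}" for k
      using that i by (subst coord_bracket_Q) auto
  qed
qed

lemma span_1_n: "{1, n} \<subseteq> {1..n}" "dim (span (x ` {1, n})) = 2"
proof -
  show *: "{1, n} \<subseteq> {1..n}" using Q_pos n by auto
  have "n \<noteq> 1" using n by auto
  then show "dim (span (x ` {1, n})) = 2" using dim_span_x[OF *] by simp
qed

text \<open>It suffices to find, for each \<open>\<xi>\<close>, an isotropic subspace of dimension \<open>q + 1\<close>. The vectors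
  orthogonal to \<open>x\<^sub>q\<^sub>+\<^sub>1, \<dots>, x\<^sub>n\<close> are cut out by only \<open>q - 1\<close> conditions, since \<open>x\<^sub>n\<close> is central, so
  one of them lies outside the \<open>q\<close>-dimensional span of \<open>x\<^sub>q\<^sub>+\<^sub>1, \<dots>, x\<^sub>n\<close> and enlarges it.\<close>

lemma stabilizer_dim_ge_Q:
  assumes \<xi>: "Vector_Spaces.linear scale (*) \<xi>"
  shows "2 \<le> dim (stabilizer \<xi>)"
proof -
  let ?S = "x ` {q + 1..n}"
  let ?K = "{u \<in> UNIV. \<forall>c\<in>{q + 1..n - 1}. \<xi> (bracket u (x c)) = 0}"
  have dim_S: "dim (span ?S) = q"
    using dim_span_x[of "{q + 1..n}"] n by simp
  have "dim (UNIV :: 'a set) \<le> dim ?K + card {q + 1..n - 1}"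
    by (rule dim_common_kernel)
      (auto simp: bracket_add_left bracket_scale_left linear_functionalD[OF \<xi>])
  then have "dim ?K \<ge> q + 1"
    using dim_whole_space Q_pos n by simp
  then have "\<not> ?K \<subseteq> span ?S"
    using dim_subset[of ?K "span ?S"] dim_S by auto
  then obtain y where y: "y \<in> ?K" "y \<notin> span ?S" by blast
  let ?P = "span (insert y ?S)"
  have dim_P: "dim ?P = q + 1"
    using y(2) dim_S by (simp add: dim_insert)
  have y_S: "\<xi> (bracket y (x j)) = 0" if "j \<in> {q + 1..n}" for j
    using y(1) that linear_functionalD(3)[OF \<xi>] by (cases "j = n") (auto simp: central_Q)
  have S_y: "\<xi> (bracket (x j) y) = 0" if "j \<in> {q + 1..n}" for j
    using y_S[OF that] by (subst bracket_swap) (simp add: linear_functionalD[OF \<xi>])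
  have "2 * dim ?P \<le> n + dim (?P \<inter> stabilizer \<xi>)"
  proof (rule isotropic_dim_bound[OF \<xi>])
    fix a b assume "a \<in> ?P" "b \<in> ?P"
    have "bracket a b \<in> {v. \<xi> v = 0}"
    proof (rule bracket_span_subset[OF subspace_kernel[OF \<xi>] _ \<open>a \<in> ?P\<close> \<open>b \<in> ?P\<close>])
      fix a b assume "a \<in> insert y ?S" "b \<in> insert y ?S"
      then show "bracket a b \<in> {v. \<xi> v = 0}"
        using y_S S_y commuting_Q linear_functionalD(3)[OF \<xi>] by (auto simp: bracket_alternating)
    qed
    then show "\<xi> (bracket a b) = 0" by simp
  qed simp
  also have "\<dots> \<le> n + dim (stabilizer \<xi>)" by (simp add: dim_subset)
  finally show ?thesis using dim_P n by simp
qed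

lemma magic_number_Q: "magic_number = q + 1"
proof -
  have "dim (stabilizer (coord n)) \<le> 2"
    using dim_subset[OF stabilizer_coord_Q] span_1_n(2) by simp
  then have "index = 2"
    by (rule index_eqI[OF linear_coord]) (rule stabilizer_dim_ge_Q)
  then show ?thesis using n unfolding magic_number_def dim_whole_space by simp
qed

lemma abelian_Q: "abelian_subalgebra (span (x ` {q + 1..n}))" "dim (span (x ` {q + 1..n})) = q"
proof -
  show "abelian_subalgebra (span (x ` {q + 1..n}))"
    by (rule abelian_span) (use commuting_Q in auto)
  show "dim (span (x ` {q + 1..n})) = q"
    using dim_span_x[of "{q + 1..n}"] n by simp
qed

lemma rentschler_Q: "rentschler"
  using abelian_Q magic_number_Q unfolding rentschler_def
  by (intro disjI2 exI[of _ "span (x ` {q + 1..n})"]) simp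

lemma centralizer_x1_Q:
  assumes "bracket (x 1) v = 0"
  shows "v \<in> span (x ` {1, n - 1, n})"
proof (rule in_span_x_if_coords_vanish)
  show "{1, n - 1, n} \<subseteq> {1..n}" using Q_pos n by auto
  fix i assume i: "i \<in> {1..n} - {1, n - 1, n}"
  have "0 = coord (i + 1) (bracket (x 1) v)" by (simp only: assms coord_zero)
  also have "\<dots> = (\<Sum>k=1..n. coord k v * coord (i + 1) (bracket (x 1) (x k)))"
    by (subst expansion[of v])
      (simp add: bracket_sum_right coord_sum bracket_scale_right coord_scale)
  also have "\<dots> = (\<Sum>k=1..n. if k = i then coord k v else 0)"
  proof (rule sum.cong)
    fix k assume k: "k \<in> {1..n}"
    show "coord k v * coord (i + 1) (bracket (x 1) (x k)) = (if k = i then coord k v else 0)"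
    proof (cases "k = 1")
      case True
      then show ?thesis using i by (auto simp: bracket_alternating)
    next
      case False
      then have "bracket (x 1) (x k) = (if k + 2 \<le> n then x (k + 1) else 0)"
        using k by (subst bracket_Q) auto
      then show ?thesis using i k by (auto simp: coord_x)
    qed
  qed simp
  also have "\<dots> = coord i v" using i by simp
  finally show "coord i v = 0" by simp
qed

text \<open>For an abelian \<open>P\<close> of dimension above \<open>q\<close> and \<open>\<xi>\<close> the last coordinate, the isotropic bound forces
  \<open>dim (P \<inter> L(\<xi>)) \<ge> 2\<close>, so \<open>P\<close> contains all of the two-dimensional span of \<open>x\<^sub>1\<close> and \<open>x\<^sub>n\<close>. Then \<open>P\<close>
  lies in the three-dimensional centralizer of \<open>x\<^sub>1\<close>, although \<open>q + 1 \<ge> 4\<close>.\<close>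

lemma alpha_Q:
  assumes "n \<ge> 6"
  shows "alpha = q"
proof (rule alpha_eqI[OF abelian_Q])
  fix P assume P: "abelian_subalgebra P"
  show "dim P \<le> q"
  proof (rule ccontr)
    assume big: "\<not> dim P \<le> q"
    let ?R = "span (x ` {1, n})"
    let ?D = "P \<inter> stabilizer (coord n)"
    have "2 * dim P \<le> n + dim ?D"
      by (rule abelian_dim_bound[OF linear_coord P])
    then have "2 \<le> dim ?D" using big n by simp
    moreover have "subspace ?D"
      using P subspace_stabilizer[OF linear_coord] by (auto simp: abelian_subalgebra_def subspace_inter)
    ultimately have "?D = ?R"
      using stabilizer_coord_Q span_1_n(2) by (intro subspace_dim_equal) auto
    then have "x 1 \<in> P" using span_base[of "x 1" "x ` {1, n}"] by auto
    then have "P \<subseteq> span (x ` {1, n - 1, n})"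
      using P centralizer_x1_Q by (auto simp: abelian_subalgebra_def)
    then have "dim P \<le> dim (span (x ` {1, n - 1, n}))" by (rule dim_subset)
    also have "\<dots> = card {1, n - 1, n}"
      using assms by (intro dim_span_x) auto
    also have "\<dots> \<le> 3" by (simp add: card_insert_if)
    finally show False using big assms n by simp
  qed
qed

text \<open>Beside the commuting variables \<open>x\<^sub>q\<^sub>+\<^sub>1, \<dots>, x\<^sub>n\<close> one generator \<open>f\<close> is needed. Bracketing \<open>f\<close> with
  \<open>x\<^sub>i\<close>, its first term contributes \<open>x\<^sub>n x\<^sub>i\<^sub>+\<^sub>1\<close> (for \<open>i \<le> n - 2\<close>), and the only other contribution is
  the term with \<open>j = n + 1 - i\<close>, in which the sign \<open>(-1)\<^sup>j\<close> is chosen to give \<open>- x\<^sub>n x\<^sub>i\<^sub>+\<^sub>1\<close>.\<close>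

lemma milovanov_Q: "milovanov n x"
proof -
  let ?I = "{q + 1..n}"
  define f :: "(nat, 'k) mpoly" where "f = var_poly 1 * var_poly n +
    (\<Sum>j=3..q. const_poly ((- 1) ^ j) * (var_poly j * var_poly (n + 2 - j)))"
  \<comment> \<open>Each product \<open>x\<^sub>j x\<^sub>n\<^sub>+\<^sub>2\<^sub>-\<^sub>j\<close> in the sum has a factor among the variables killed here.\<close>
  define \<phi> :: "nat \<Rightarrow> (nat, 'k) mpoly" where "\<phi> i = (if i \<in> insert 1 ?I then var_poly i else 0)" for i
  let ?e = "Poly_Mapping.single 1 1 + Poly_Mapping.single n 1 :: nat \<Rightarrow>\<^sub>0 nat"
  have "substitute \<phi> f = \<phi> 1 * \<phi> n + (\<Sum>j=3..q. const_poly ((- 1) ^ j) * (\<phi> j * \<phi> (n + 2 - j)))"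
    by (simp add: f_def substitute_add substitute_mult substitute_sum)
  also have "(\<Sum>j=3..q. const_poly ((- 1) ^ j) * (\<phi> j * \<phi> (n + 2 - j))) = 0"
    by (rule sum.neutral) (auto simp: \<phi>_def)
  also have "\<phi> 1 * \<phi> n = var_poly 1 * var_poly n"
    using n Q_pos by (simp add: \<phi>_def)
  also have "\<dots> = Poly_Mapping.single ?e 1"
    by (simp add: var_poly_def mult_single)
  finally have \<phi>_f: "substitute \<phi> f = Poly_Mapping.single ?e 1" by simp
  have \<phi>_var: "\<phi> i = var_poly i" if "i \<in> ?I" for i using that by (simp add: \<phi>_def)
  have indep: "f \<notin> var_poly ` ?I" "alg_independent (insert f (var_poly ` ?I))"
    using alg_independent_insert_variables[of ?I \<phi>, OF \<phi>_var \<phi>_f, of 1] Q_pos n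
    by (auto simp: lookup_add lookup_single)
  have f_var: "poisson n x f (var_poly i) = 0" if i: "i \<in> ?I" for i
  proof -
    have i': "i \<in> {1..n}" "i \<ge> 2" using i Q_pos by auto
    have var0: "poisson n x (var_poly k) (var_poly i) = 0" if "k \<in> ?I" for k
      using that i commuting_Q by (subst poisson_var) auto
    have var1: "poisson n x (var_poly 1) (var_poly i) = (if i + 2 \<le> n then var_poly (i + 1) else 0)"
    proof -
      have "bracket (x 1) (x i) = (if i + 2 \<le> n then x (i + 1) else 0)"
        using i' by (subst bracket_Q) auto
      then have "poisson n x (var_poly 1) (var_poly i) =
          linear_form n x (if i + 2 \<le> n then x (i + 1) else 0)"
        using i' by (subst poisson_var) auto
      then show ?thesis
        using linear_form_x[of "i + 1"] by (cases "i + 2 \<le> n") auto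
    qed
    have varj: "poisson n x (var_poly j) (var_poly i) =
        (if j = n + 1 - i then - (const_poly ((- 1) ^ j) * var_poly n) else 0)" if "j \<in> {3..q}" for j
    proof -
      have j: "j \<in> {1..n}" "2 \<le> j" "j < i" using that i n by auto
      have "poisson n x (var_poly j) (var_poly i) = linear_form n x (bracket (x j) (x i))"
        using j i' by (intro poisson_var) auto
      also have "bracket (x j) (x i) = (if j = n + 1 - i then scale ((- 1) ^ (j + 1)) (x n) else 0)"
        using j i' by (subst bracket_Q) auto
      also have "linear_form n x \<dots> = (if j = n + 1 - i then const_poly ((- 1) ^ (j + 1)) * var_poly n else 0)"
        unfolding if_distrib[of "linear_form n x"] linear_form_scale linear_form_zero
        using linear_form_x[of n] i' by simp
      also have "const_poly ((- 1) ^ (j + 1)) = - (const_poly ((- 1) ^ j) :: (nat, 'k) mpoly)"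
        by (simp add: const_poly_def single_uminus)
      finally show ?thesis by simp
    qed
    have "poisson n x f (var_poly i) = var_poly n * (if i + 2 \<le> n then var_poly (i + 1) else 0) +
        (\<Sum>j=3..q. const_poly ((- 1) ^ j) * (var_poly (n + 2 - j) * poisson n x (var_poly j) (var_poly i)))"
    proof -
      have "poisson n x (const_poly ((- 1) ^ j) * (var_poly j * var_poly (n + 2 - j))) (var_poly i) =
          const_poly ((- 1) ^ j) * (var_poly (n + 2 - j) * poisson n x (var_poly j) (var_poly i))"
        if "j \<in> {3..q}" for j
      proof -
        have "poisson n x (var_poly (n + 2 - j)) (var_poly i) = 0"
          by (rule var0) (use that n in auto)
        then show ?thesis by (simp add: poisson_mult_left)
      qed
      then have "poisson n x (\<Sum>j=3..q. const_poly ((- 1) ^ j) * (var_poly j * var_poly (n + 2 - j))) (var_poly i) =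
          (\<Sum>j=3..q. const_poly ((- 1) ^ j) * (var_poly (n + 2 - j) * poisson n x (var_poly j) (var_poly i)))"
        unfolding poisson_sum_left by (intro sum.cong refl)
      moreover have "poisson n x (var_poly n) (var_poly i) = 0"
        using n Q_pos by (intro var0) auto
      ultimately show ?thesis
        unfolding f_def poisson_add_left poisson_mult_left[of "var_poly 1"] var1 by simp
    qed
    also have "(\<Sum>j=3..q. const_poly ((- 1) ^ j) * (var_poly (n + 2 - j) * poisson n x (var_poly j) (var_poly i)))
        = (\<Sum>j=3..q. if j = n + 1 - i then - (var_poly n * var_poly (i + 1)) else 0)"
    proof (rule sum.cong)
      fix j assume j: "j \<in> {3..q}"
      have "const_poly ((- 1) ^ j) * const_poly ((- 1) ^ j) = (1 :: (nat, 'k) mpoly)"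
        by (simp flip: const_poly_mult power_add)
      then have sign: "const_poly ((- 1) ^ j) * (var_poly (i + 1) * - (const_poly ((- 1) ^ j) * var_poly n)) =
          - (var_poly n * var_poly (i + 1) :: (nat, 'k) mpoly)"
        by (metis (no_types, lifting) mult.assoc mult.commute mult.left_neutral mult_minus_right)
      show "const_poly ((- 1) ^ j) * (var_poly (n + 2 - j) * poisson n x (var_poly j) (var_poly i)) =
          (if j = n + 1 - i then - (var_poly n * var_poly (i + 1)) else 0)"
      proof (cases "j = n + 1 - i")
        case True
        then have "n + 2 - j = i + 1" using i by auto
        then show ?thesis unfolding varj[OF j] if_P[OF True] by (simp only: sign)
      qed (simp add: varj[OF j])
    qed simp
    also have "\<dots> = - (var_poly n * (if i + 2 \<le> n then var_poly (i + 1) else 0))"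
      using i n by auto
    finally show ?thesis by simp
  qed
  show ?thesis
  proof (rule milovanov_of_generators[OF _ _ indep(2)])
    show "finite (insert f (var_poly ` ?I))" by simp
    have "card (var_poly ` ?I :: (nat, 'k) mpoly set) = q"
      using n by (simp add: card_image[OF inj_on_subset[OF inj_var_poly]])
    then show "card (insert f (var_poly ` ?I)) = magic_number"
      using indep(1) magic_number_Q by simp
    have var: "var_poly i \<in> (sym_algebra n :: (nat, 'k) mpoly set)" if "i \<in> {1..n}" for i
      using that by (simp add: sym_algebra_def variables_var)
    have sub: "g * h \<in> sym_algebra n" "g + h \<in> sym_algebra n"
      if "g \<in> sym_algebra n" "h \<in> sym_algebra n" for g h :: "(nat, 'k) mpoly"
      using that unital_subalgebra_sym_algebra[of n] by (auto simp: unital_subalgebra_def)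
    have const: "const_poly c \<in> (sym_algebra n :: (nat, 'k) mpoly set)" for c
      by (simp add: sym_algebra_def)
    have sub_sum: "(\<Sum>j\<in>J. g j) \<in> sym_algebra n" if "\<And>j. j \<in> J \<Longrightarrow> g j \<in> sym_algebra n"
      for g :: "nat \<Rightarrow> (nat, 'k) mpoly" and J
      using that by (induction J rule: infinite_finite_induct) (use const[of 0] in \<open>auto intro: sub\<close>)
    have "f \<in> sym_algebra n"
      unfolding f_def using n Q_pos by (intro sub sub_sum var const) auto
    then show "insert f (var_poly ` ?I) \<subseteq> sym_algebra n" using var by auto
    have deg: "degree_le 2 (var_poly i * var_poly j :: (nat, 'k) mpoly)" for i j
      using degree_le_mult[OF degree_le_var degree_le_var] by (simp add: numeral_2_eq_2)
    have "degree_le 2 (const_poly c * (var_poly i * var_poly j) :: (nat, 'k) mpoly)" for c i j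
      using degree_le_mult[OF degree_le_const[of 0 c] deg[of i j]] by (simp only: add_0)
    then have "degree_le 2 f"
      unfolding f_def by (intro degree_le_add deg degree_le_sum)
    moreover have "degree_le 2 (var_poly i :: (nat, 'k) mpoly)" for i
      by (rule degree_le_mono[OF degree_le_var]) simp
    ultimately show "degree_le 2 g" if "g \<in> insert f (var_poly ` ?I)" for g using that by auto
    have "poisson n x (var_poly i) f = 0" if "i \<in> ?I" for i
      using f_var[OF that] poisson_swap[of "var_poly i" f] by simp
    moreover have "poisson n x (var_poly i) (var_poly j) = 0" if "i \<in> ?I" "j \<in> ?I" for i j
      using that commuting_Q by (subst poisson_var) auto
    ultimately show "poisson n x g h = 0"
      if "g \<in> insert f (var_poly ` ?I)" "h \<in> insert f (var_poly ` ?I)" for g h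
      using that f_var by auto
  qed
qed

end

end


section \<open>Rentschler's property and Milovanov's conjecture\<close>

theorem theorem8p6:
  fixes scale :: "'k::{alg_closed_field, field_char_0} \<Rightarrow> 'a::ab_group_add \<Rightarrow> 'a"
    and bracket :: "'a \<Rightarrow> 'a \<Rightarrow> 'a"
    and n :: nat and x :: "nat \<Rightarrow> 'a"
  assumes "lie_algebra scale bracket"
    and "lie_algebra.filiform scale bracket n"
    and "lie_algebra.type_L scale bracket n x \<or> lie_algebra.type_Q scale bracket n x \<or>
         lie_algebra.type_R scale bracket n x \<or> lie_algebra.type_W scale bracket n x"
  shows "lie_algebra.rentschler scale bracket \<and>
    (lie_algebra.type_L scale bracket n x \<or> lie_algebra.type_R scale bracket n x \<or>
       lie_algebra.type_W scale bracket n x \<longrightarrow> (\<exists>P. lie_algebra.CP scale bracket P)) \<and>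
    (lie_algebra.type_L scale bracket n x \<longrightarrow> lie_algebra.alpha scale bracket = n - 1) \<and>
    (lie_algebra.type_Q scale bracket n x \<and> n \<ge> 6 \<longrightarrow>
       lie_algebra.alpha scale bracket = n div 2) \<and>
    (lie_algebra.type_R scale bracket n x \<longrightarrow> lie_algebra.alpha scale bracket = n - 2) \<and>
    (lie_algebra.type_W scale bracket n x \<longrightarrow>
       lie_algebra.alpha scale bracket = (n + 2) div 2) \<and>
    lie_algebra.milovanov scale bracket n x"
proof -
  interpret lie_algebra scale bracket by fact
  have "basis n x"
    using assms(3) by (auto simp: type_L_def type_Q_def type_R_def type_W_def)
  then interpret based_lie_algebra scale bracket n x by unfold_locales
  have q: "n = 2 * (n div 2)" if "type_Q n x" using that by (auto simp: type_Q_def)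
  have Q: "rentschler" "milovanov n x" "n \<ge> 6 \<Longrightarrow> alpha = n div 2" if "type_Q n x"
    by (rule rentschler_Q milovanov_Q alpha_Q; use that q in simp)+
  have rentschler if "CP P" for P using that by (auto simp: rentschler_def)
  then show ?thesis
    using assms(3) type_L_polarized type_R_polarized type_W_polarized Q by blast
qed

end
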